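(* The number $D_{1,K}$ of pairs of consecutive roots at distance $1$ in the ballistic deposition process on the cyclic strip $[K]$ satisfies the following. (i) $E(D_{1,4})=\frac{2}{3}$ and $E(D_{1,K})=\frac{2K}{15}$ for all $K\ge 5$. (ii) $\sigma^2(D_{1,4})=\frac{8}{9}$, $\sigma^2(D_{1,5})=\frac{2}{9}$, $\sigma^2(D_{1,6})=\frac{24}{25}$, $\sigma^2(D_{1,7})=\frac{184}{225}$, $\sigma^2(D_{1,8})=\frac{1588}{1575}$, and $\sigma^2(D_{1,K})=\frac{1772K}{14175}$ for all $K\ge 9$.
   Context: Ballistic deposition on a strip: for an integer $K\ge 3$ let $[K]=\{1,\dots,K\}$, and define the (cyclic) neighbour sets $I(1)=\{K,1,2\}$, $I(k)=\{k-1,k,k+1\}$ for $2\le k\le K-1$, and $I(K)=\{K-1,K,1\}$. Let $(X_n)_{n\ge 0}$ be i.i.d. random variables uniformly distributed on $[K]$. Define random height functions $H_n:[K]\to\{0,1,2,\dots\}$ by $H_0(k)=0$ for all $k\in[K]$ and, for $n\ge 1$, $H_n(k)=H_{n-1}(k)$ if $X_n\ne k$, and $H_n(k)=\max_{j\in I(k)}H_{n-1}(j)+1$ if $X_n=k$. The set of roots eventually formed is $\mathcal R^{[K]}=\{k\in[K]: H_i(k)=1 \text{ for some } i\ge 1\}$, and $R^{[K]}=\mathrm{Card}(\mathcal R^{[K]})$. Let $r_1<\cdots<r_{R^{[K]}}$ be the ordered locations of the roots. For $1\le i\le K-1$ let $D_{i,K}=\sum_{j=1}^{R^{[K]}-1}\mathbf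 1_{\{r_{j+1}-r_j=i+1\}}+\mathbf 1_{\{r_{R^{[K]}}-r_1=K-i-1\}}$ be the number of pairs of (cyclically) consecutive roots with distance $i$ (that is, $i$ non-root sites) between them. $E(X)$ and $\sigma^2(X)$ denote the mean and variance of a random variable $X$. *)

theory Defs
  imports "HOL-Probability.Probability"
begin

text \<open>The strip is \<open>{1..K}\<close>; the functions below are only meaningful for sites in this set.\<close>

definition nbrs :: "nat \<Rightarrow> nat \<Rightarrow> nat set" where
  "nbrs K k =
    (if k = 1 then {K, 1, 2} else if k = K then {K - 1, K, 1} else {k - 1, k, k + 1})"

text \<open>A realisation of the deposition sequence is a function \<open>x :: nat \<Rightarrow> nat\<close>. The particle
  \<open>x n\<close> produces the step from time \<open>n - 1\<close> to time \<open>n\<close>, so \<open>x 0\<close> is never used.\<close>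

primrec height :: "nat \<Rightarrow> (nat \<Rightarrow> nat) \<Rightarrow> nat \<Rightarrow> nat \<Rightarrow> nat" where
  "height K x 0 = (\<lambda>k. 0)"
| "height K x (Suc n) =
    (\<lambda>k. if x (Suc n) = k then Max (height K x n ` nbrs K k) + 1 else height K x n k)"

definition roots :: "nat \<Rightarrow> (nat \<Rightarrow> nat) \<Rightarrow> nat set" where
  "roots K x = {k \<in> {1..K}. \<exists>i\<ge>1. height K x i k = 1}"

text \<open>\<open>root_at K x j\<close> is the \<open>j\<close>-th smallest root, for \<open>1 \<le> j \<le> card (roots K x)\<close>.\<close>

definition root_at :: "nat \<Rightarrow> (nat \<Rightarrow> nat) \<Rightarrow> nat \<Rightarrow> nat" where
  "root_at K x j = sorted_list_of_set (roots K x) ! (j - 1)"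

text \<open>If \<open>x\<close> takes its values in \<open>{1..K}\<close>, then site \<open>x 1\<close> is a root, so \<open>roots K x\<close> is nonempty
  and the first and last roots exist. Since \<open>root_at\<close> is increasing and \<open>1 \<le> i \<le> K - 1\<close>, none of
  the subtractions on \<^typ>\<open>nat\<close> truncates.\<close>

definition num_gaps :: "nat \<Rightarrow> nat \<Rightarrow> (nat \<Rightarrow> nat) \<Rightarrow> nat" where
  "num_gaps i K x =
    (let R = card (roots K x); r = root_at K x in
      (\<Sum>j = 1..R - 1. of_bool (r (j + 1) - r j = i + 1)) + of_bool (r R - r 1 = K - i - 1))"

end

theory Submission
  imports Defs
begin

text \<open>
  A particle that falls on \<open>k\<close> gives height 1 exactly when nothing has fallen on \<open>k\<close> or on a
  neighbour of \<open>k\<close> before. Hence \<open>k\<close> is a root if and only if it is hit for the first time before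
  both of its neighbours are (\<open>roots_iff\<close>), and the set of roots depends only on the order in which
  the sites are hit for the first time.

  This order is a uniformly distributed permutation of the sites. Indeed, a fixed relabelling of the
  sites does not change the law of an independent uniform sequence, so all orders are equally
  likely, and almost surely every site is hit (\<open>expectation_first_hit_order\<close>). The theorem is
  thereby reduced to a question about uniform random permutations.

  Since two neighbours are never both roots, \<open>D\<close> is the number of \<open>k\<close> modulo \<open>K\<close> such that the
  sites \<open>k + 1\<close> and \<open>k + 3\<close> are roots (\<open>num_gaps_1_eq\<close>). Such an event prescribes that the
  first-hit times of the five sites \<open>k, \<dots>, k + 4\<close> form a zigzag high-low-high-low-high. The
  probability \<open>a\<^sub>n\<close> of a zigzag with \<open>n\<close> low points on \<open>2 n + 1\<close> distinct sites follows
  Andre's recursion for alternating permutations: the site that comes first must be a low point, and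
  the zigzags on its two sides are independent, so that
  \<open>(2 n + 3) a\<^bsub>n + 1\<^esub> = (\<Sum>j\<le>n. a\<^sub>j a\<^bsub>n - j\<^esub>)\<close> (\<open>prob_zigzag\<close>). The same idea applied to a zigzag
  that closes up to a cycle gives \<open>a\<^sub>n / 2\<close> for a cycle of length \<open>2 n + 2\<close> (\<open>prob_cyclic_zigzag\<close>);
  it occurs when \<open>K \<le> 8\<close> is even, where the sites in question wrap around the whole strip.

  The mean of \<open>D\<close> is \<open>K\<close> times the probability of one event. For the second moment one sums the
  probability that the events at \<open>k\<close> and \<open>k + d\<close> both occur, over \<open>k\<close> and \<open>d\<close> modulo \<open>K\<close>. For \<open>d\<close>
  equal to 1 or 3 two neighbours would both be roots; for \<open>d\<close> equal to 2 or 4 the two zigzags join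
  to one zigzag, which is open or closed according to the size of \<open>K\<close>, except that for \<open>d = 2\<close>
  they coincide if \<open>K = 4\<close> and exclude each other if \<open>K = 5\<close>; for \<open>5 \<le> d \<le> K - 5\<close> the two sets
  of sites are disjoint and the events are independent; the other \<open>d\<close> follow from the reflection
  \<open>d \<mapsto> K - d\<close>.
\<close>

section \<open>Zigzag patterns in a linear order\<close>

text \<open>A list is read as a linear order of its entries. An entry precedes everything that does not
  occur in the list, just as a site that is hit counts as earlier than one that never is.\<close>
primrec precedes :: "'a list \<Rightarrow> 'a \<Rightarrow> 'a \<Rightarrow> bool" where
  "precedes [] a b \<longleftrightarrow> False"
| "precedes (x # l) a b \<longleftrightarrow> x \<noteq> b \<and> (x = a \<or> precedes l a b)"

text \<open>The entries of the pattern at odd positions, counted from 0, are its low points, and the others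
  its high points: each low point comes earlier in \<open>l\<close> than the entries next to it. The patterns
  that matter have odd length, so that both ends are high. A pattern may end with the entry that it
  starts with, which expresses a zigzag around a cycle.\<close>
fun zigzag :: "'a list \<Rightarrow> 'a list \<Rightarrow> bool" where
  "zigzag l (a # b # c # w) \<longleftrightarrow> precedes l b a \<and> precedes l b c \<and> zigzag l (c # w)"
| "zigzag l w \<longleftrightarrow> True"

lemma precedes_asym: "precedes l a b \<Longrightarrow> \<not> precedes l b a"
  by (induction l) auto

lemma precedes_filter:
  "a \<in> U \<Longrightarrow> b \<in> U \<Longrightarrow> precedes (filter (\<lambda>x. x \<in> U) l) a b = precedes l a b"
  by (induction l) auto

lemma zigzag_filter:
  "set w \<subseteq> U \<Longrightarrow> zigzag (filter (\<lambda>x. x \<in> U) l) w = zigzag l w"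
  by (induction l w rule: zigzag.induct) (auto simp: precedes_filter)

lemma zigzag_Cons_notin: "x \<notin> set w \<Longrightarrow> zigzag (x # l) w = zigzag l w"
  by (induction l w rule: zigzag.induct) auto

text \<open>A pattern may be cut at any high point, which then belongs to both parts.\<close>
lemma zigzag_append:
  "odd (length u) \<Longrightarrow> zigzag l (u @ v) \<longleftrightarrow> zigzag l u \<and> zigzag l (last u # v)"
proof (induction l u rule: zigzag.induct)
  case (1 l a b c w)
  then show ?case by (cases w) auto
qed auto

text \<open>The step behind the recursion: if the first element of the order is a low point of the pattern,
  then its own constraints hold and what remains are the patterns on its two sides.\<close>
lemma zigzag_Cons_low:
  assumes "odd (length u)" "v \<noteq> []" "x \<notin> set u" "x \<notin> set v"
  shows "zigzag (x # l) (u @ x # v) \<longleftrightarrow> zigzag l u \<and> zigzag l v"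
proof -
  obtain c w where v: "v = c # w" using assms(2) by (cases v) auto
  have "u \<noteq> []" using assms(1) by auto
  hence "last u \<in> set u" by simp
  hence "x \<noteq> last u" "x \<noteq> c" using assms v by auto
  thus ?thesis
    using assms by (auto simp: zigzag_append v zigzag_Cons_notin)
qed

text \<open>The first element of the order is not a high point, since each high point has a low neighbour
  that comes before it.\<close>
lemma zigzag_Cons_high:
  assumes "even (length u)" "u @ v \<noteq> []" "odd (length (u @ x # v))" "x \<notin> set u"
  shows "\<not> zigzag (x # l) (u @ x # v)"
proof (cases "u = []")
  case True
  then obtain b c w where "v = b # c # w"
    using assms by (cases v; cases "tl v") auto
  with True show ?thesis by auto
next
  case False
  then obtain u1 b where u: "u = u1 @ [b]" by (cases u rule: rev_cases) auto
  have "zigzag (x # l) (u1 @ (b # x # v)) \<longleftrightarrow> zigzag (x # l) u1 \<and> zigzag (x # l) (last u1 # b # x # v)"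
    using assms(1) u by (intro zigzag_append) auto
  thus ?thesis using u by auto
qed

section \<open>Uniform random permutations\<close>

abbreviation perm_pmf :: "'a set \<Rightarrow> 'a list pmf" where
  "perm_pmf A \<equiv> pmf_of_set (permutations_of_set A)"

text \<open>Splitting a uniform permutation of \<open>A\<close> along \<open>U\<close> yields two independent uniform permutations:
  each pair of orders arises from the same number of shuffles.\<close>
lemma perm_pmf_filter_indep:
  assumes "finite A" "U \<subseteq> A"
  shows "measure_pmf.prob (perm_pmf A)
      {l. P (filter (\<lambda>x. x \<in> U) l) \<and> Q (filter (\<lambda>x. x \<notin> U) l)} =
    measure_pmf.prob (perm_pmf U) {l. P l} * measure_pmf.prob (perm_pmf (A - U)) {l. Q l}"
proof -
  have U: "{x \<in> A. x \<in> U} = U" "{x \<in> A. x \<notin> U} = A - U"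
    using assms(2) by auto
  have *: "map_pmf (partition (\<lambda>x. x \<in> U)) (perm_pmf A) = pair_pmf (perm_pmf U) (perm_pmf (A - U))"
    using partition_random_permutations[OF assms(1), of "\<lambda>x. x \<in> U"] by (simp add: U)
  have "measure_pmf.prob (perm_pmf A)
      {l. P (filter (\<lambda>x. x \<in> U) l) \<and> Q (filter (\<lambda>x. x \<notin> U) l)} =
    measure_pmf.prob (map_pmf (partition (\<lambda>x. x \<in> U)) (perm_pmf A)) ({l. P l} \<times> {l. Q l})"
    by (simp add: vimage_def o_def)
  also have "\<dots> = measure_pmf.prob (perm_pmf U) {l. P l} * measure_pmf.prob (perm_pmf (A - U)) {l. Q l}"
    unfolding * using finite_subset[OF assms(2,1)] assms(1)
    by (subst measure_Int_set_pmf[symmetric], subst (2) measure_Int_set_pmf[symmetric],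
        subst (3) measure_Int_set_pmf[symmetric])
       (auto simp: Times_Int_Times intro!: measure_pmf_prob_product countable_finite)
  finally show ?thesis .
qed

lemma perm_pmf_filter:
  assumes "finite A" "U \<subseteq> A"
  shows "measure_pmf.prob (perm_pmf A) {l. P (filter (\<lambda>x. x \<in> U) l)} =
    measure_pmf.prob (perm_pmf U) {l. P l}"
  using perm_pmf_filter_indep[OF assms, of P "\<lambda>_. True"] by simp

text \<open>Conditioning on the first entry, which is uniform on \<open>A\<close> and leaves a uniform permutation of
  the other elements.\<close>
lemma perm_pmf_first:
  assumes "finite A" "A \<noteq> {}"
  shows "measure_pmf.prob (perm_pmf A) {l. P l} =
    (\<Sum>x\<in>A. measure_pmf.prob (perm_pmf (A - {x})) {l. P (x # l)}) / card A"
proof -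
  have "perm_pmf A = pmf_of_set A \<bind> (\<lambda>x. map_pmf ((#) x) (perm_pmf (A - {x})))"
    by (subst random_permutation_of_set[OF assms]) (simp add: map_pmf_def)
  also have "measure_pmf.prob \<dots> {l. P l} =
    measure_pmf.expectation (pmf_of_set A)
      (\<lambda>x. measure_pmf.prob (map_pmf ((#) x) (perm_pmf (A - {x}))) {l. P l})"
    unfolding measure_pmf_bind
    by (rule measure_pmf.measure_bind[where N = "count_space UNIV"])
       (simp_all add: measure_pmf_in_subprob_algebra)
  finally show ?thesis
    using assms by (simp add: integral_pmf_of_set vimage_def)
qed

lemma prob_zigzag_indep:
  assumes "finite A" "set u \<subseteq> A" "set v \<subseteq> A" "set u \<inter> set v = {}"
  shows "measure_pmf.prob (perm_pmf A) {l. zigzag l u \<and> zigzag l v} =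
    measure_pmf.prob (perm_pmf (set u)) {l. zigzag l u} *
    measure_pmf.prob (perm_pmf (set v)) {l. zigzag l v}"
proof -
  have v: "set v \<subseteq> A - set u" using assms by auto
  have "zigzag (filter (\<lambda>x. x \<notin> set u) l) v = zigzag l v" for l
    using zigzag_filter[of v "- set u" l] assms(4) by auto
  hence "measure_pmf.prob (perm_pmf A) {l. zigzag l u \<and> zigzag l v} =
    measure_pmf.prob (perm_pmf (set u)) {l. zigzag l u} *
    measure_pmf.prob (perm_pmf (A - set u)) {l. zigzag l v}"
    using perm_pmf_filter_indep[OF assms(1,2), of "\<lambda>l. zigzag l u" "\<lambda>l. zigzag l v"]
    by (simp add: zigzag_filter)
  also have "measure_pmf.prob (perm_pmf (A - set u)) {l. zigzag l v} =
      measure_pmf.prob (perm_pmf (set v)) {l. zigzag l v}"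
    using perm_pmf_filter[OF _ v, of "\<lambda>l. zigzag l v"] assms(1) by (simp add: zigzag_filter)
  finally show ?thesis .
qed

lemma prob_zigzag_set:
  assumes "finite A" "set w \<subseteq> A"
  shows "measure_pmf.prob (perm_pmf A) {l. zigzag l w} =
    measure_pmf.prob (perm_pmf (set w)) {l. zigzag l w}"
  using prob_zigzag_indep[OF assms, of "[]"] by simp

section \<open>The probability of a zigzag\<close>

text \<open>This is \<open>E\<^bsub>2 n + 1\<^esub> / (2 n + 1)!\<close>, where the \<open>E\<^bsub>2 n + 1\<^esub>\<close> are the tangent numbers 1, 2, 16,
  272, 7936; equivalently the coefficient of \<open>x\<^bsup>2 n + 1\<^esup>\<close> in the power series of the tangent.\<close>
fun zigzag_prob :: "nat \<Rightarrow> real" where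
  "zigzag_prob 0 = 1"
| "zigzag_prob (Suc n) = (\<Sum>j\<le>n. zigzag_prob j * zigzag_prob (n - j)) / (2 * n + 3)"

lemma zigzag_prob_values:
  "zigzag_prob (Suc 0) = 1 / 3" "zigzag_prob 2 = 2 / 15"
  "zigzag_prob 3 = 17 / 315" "zigzag_prob 4 = 62 / 2835"
proof -
  show 1: "zigzag_prob (Suc 0) = 1 / 3" by simp
  show 2: "zigzag_prob 2 = 2 / 15" by (simp add: eval_nat_numeral)
  show 3: "zigzag_prob 3 = 17 / 315"
    using zigzag_prob.simps(2)[of 2] 1 2 by (simp add: eval_nat_numeral)
  show "zigzag_prob 4 = 62 / 2835"
    using zigzag_prob.simps(2)[of 3] 1 2 3 by (simp add: eval_nat_numeral)
qed

lemma sum_odd_indices: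
  fixes f :: "nat \<Rightarrow> real"
  assumes "\<And>j. j \<le> n \<Longrightarrow> f (2 * j) = 0"
  shows "(\<Sum>i<2 * n + 1. f i) = (\<Sum>j<n. f (2 * j + 1))"
  using assms
proof (induction n)
  case (Suc n)
  have "f (2 * Suc n) = 0" by (rule Suc.prems) simp
  with Suc show ?case by simp
qed simp

text \<open>The summands of the recursion, before the probabilities of the two shorter zigzags are known.\<close>
lemma prob_zigzag_first_at:
  assumes "distinct w" "odd (length w)" "length w \<ge> 3" "i < length w"
  shows "measure_pmf.prob (perm_pmf (set w - {w ! i})) {l. zigzag (w ! i # l) w} =
    (if even i then 0 else
      measure_pmf.prob (perm_pmf (set w)) {l. zigzag l (take i w)} *
      measure_pmf.prob (perm_pmf (set w)) {l. zigzag l (drop (Suc i) w)})"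
proof -
  define x u v where "x = w ! i" and "u = take i w" and "v = drop (Suc i) w"
  have w: "w = u @ x # v"
    unfolding x_def u_def v_def using assms(4) by (rule id_take_nth_drop)
  have lu: "length u = i" using assms(4) by (simp add: u_def)
  have d: "x \<notin> set u" "x \<notin> set v" "set u \<inter> set v = {}"
    using assms(1) unfolding w by auto
  show ?thesis
  proof (cases "even i")
    case True
    have "\<not> zigzag (x # l) w" for l
      unfolding w by (rule zigzag_Cons_high) (use True lu d assms(2,3) w in auto)
    thus ?thesis using True by (simp add: x_def)
  next
    case False
    have sub: "set u \<subseteq> set w" "set v \<subseteq> set w" unfolding w by auto
    have "v \<noteq> []" using assms(2) False lu unfolding w by auto
    hence "zigzag (x # l) w \<longleftrightarrow> zigzag l u \<and> zigzag l v" for l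
      unfolding w by (intro zigzag_Cons_low) (use False lu d in auto)
    hence "measure_pmf.prob (perm_pmf (set w - {x})) {l. zigzag (x # l) w} =
      measure_pmf.prob (perm_pmf (set u)) {l. zigzag l u} *
      measure_pmf.prob (perm_pmf (set v)) {l. zigzag l v}"
      using prob_zigzag_indep[of "set w - {x}" u v] d by (auto simp: w)
    also have "\<dots> = measure_pmf.prob (perm_pmf (set w)) {l. zigzag l u} *
      measure_pmf.prob (perm_pmf (set w)) {l. zigzag l v}"
      using prob_zigzag_set[of "set w" u] prob_zigzag_set[of "set w" v] sub by simp
    finally show ?thesis using False by (simp add: x_def u_def v_def)
  qed
qed

text \<open>Only the relative order of the \<open>2 n + 1\<close> sites matters, so one may condition on which of them
  is first. If it is the low point at position \<open>2 j + 1\<close>, it leaves zigzags of length \<open>2 j + 1\<close>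
  and \<open>2 (n - 1 - j) + 1\<close>.\<close>
theorem prob_zigzag:
  assumes "finite A" "set w \<subseteq> A" "distinct w" "length w = 2 * n + 1"
  shows "measure_pmf.prob (perm_pmf A) {l. zigzag l w} = zigzag_prob n"
  using assms
proof (induction n arbitrary: A w rule: less_induct)
  case (less n)
  show ?case
  proof (cases n)
    case 0
    then obtain x where "w = [x]" using less.prems(4) by (auto simp: length_Suc_conv)
    thus ?thesis using 0 by simp
  next
    case (Suc m)
    have w: "set w \<noteq> {}" "card (set w) = 2 * n + 1"
      using less.prems by (auto simp: distinct_card)
    define f where "f i = measure_pmf.prob (perm_pmf (set w - {w ! i})) {l. zigzag (w ! i # l) w}" for i
    have f: "f i = (if even i then 0 else
      measure_pmf.prob (perm_pmf (set w)) {l. zigzag l (take i w)} *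
      measure_pmf.prob (perm_pmf (set w)) {l. zigzag l (drop (Suc i) w)})" if "i < 2 * n + 1" for i
      unfolding f_def using less.prems that Suc by (intro prob_zigzag_first_at) auto
    have odd: "f (2 * j + 1) = zigzag_prob j * zigzag_prob (m - j)" if "j \<le> m" for j
    proof -
      have "measure_pmf.prob (perm_pmf (set w)) {l. zigzag l (take (2 * j + 1) w)} = zigzag_prob j"
        using less.prems that Suc
        by (intro less.IH) (auto simp: set_take_subset dest: in_set_takeD)
      moreover have "measure_pmf.prob (perm_pmf (set w)) {l. zigzag l (drop (Suc (2 * j + 1)) w)} =
          zigzag_prob (m - j)"
        using less.prems that Suc
        by (intro less.IH) (auto dest: in_set_dropD)
      ultimately show ?thesis using f[of "2 * j + 1"] that Suc by simp
    qed
    have "measure_pmf.prob (perm_pmf A) {l. zigzag l w} =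
        measure_pmf.prob (perm_pmf (set w)) {l. zigzag l w}"
      using less.prems by (intro prob_zigzag_set)
    also have "\<dots> = (\<Sum>x\<in>set w. measure_pmf.prob (perm_pmf (set w - {x})) {l. zigzag (x # l) w}) / (2 * n + 1)"
      using w by (subst perm_pmf_first) auto
    also have "(\<Sum>x\<in>set w. measure_pmf.prob (perm_pmf (set w - {x})) {l. zigzag (x # l) w}) =
        (\<Sum>i<2 * n + 1. f i)"
      unfolding f_def
      by (rule sum.reindex_bij_betw[symmetric, OF bij_betw_nth]) (use less.prems in auto)
    also have "\<dots> = (\<Sum>j<n. f (2 * j + 1))"
      by (rule sum_odd_indices) (use f in simp)
    also have "\<dots> = (\<Sum>j\<le>m. zigzag_prob j * zigzag_prob (m - j))"
      unfolding Suc lessThan_Suc_atMost by (intro sum.cong refl odd) simp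
    finally show ?thesis using Suc by (simp add: add.commute)
  qed
qed

text \<open>Half of the sites on the cycle are low points, and the first one must be among them. Removing it
  opens the cycle to a zigzag on the other \<open>2 n + 1\<close> sites.\<close>
theorem prob_cyclic_zigzag:
  assumes "finite A" "set w \<subseteq> A" "distinct w" "length w = 2 * n + 2"
  shows "measure_pmf.prob (perm_pmf A) {l. zigzag l (w @ [hd w])} = zigzag_prob n / 2"
proof -
  have w: "set w \<noteq> {}" "card (set w) = 2 * n + 2"
    using assms by (auto simp: distinct_card)
  define f where "f i = measure_pmf.prob (perm_pmf (set w - {w ! i}))
    {l. zigzag (w ! i # l) (w @ [hd w])}" for i
  have f: "f i = (if even i then 0 else zigzag_prob n)" if i: "i < 2 * n + 2" for i
  proof -
    define x u v where "x = w ! i" and "u = take i w" and "v = drop (Suc i) w"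
    have wu: "w = u @ x # v"
      unfolding x_def u_def v_def using i assms(4) by (intro id_take_nth_drop) simp
    have lu: "length u = i" "length u + length v = 2 * n + 1"
      using i assms(4) by (auto simp: u_def v_def)
    have d: "x \<notin> set u" "x \<notin> set v" "set u \<inter> set v = {}" "distinct u" "distinct v"
      using assms(3) unfolding wu by auto
    show ?thesis
    proof (cases "even i")
      case True
      have "\<not> zigzag (x # l) (u @ x # v @ [hd (u @ x # v)])" for l
        by (rule zigzag_Cons_high) (use True lu d in auto)
      hence "\<not> zigzag (x # l) (w @ [hd w])" for l
        unfolding wu by simp
      thus ?thesis using True by (simp add: x_def f_def)
    next
      case False
      define h t where "h = hd w" and "t = tl u"
      have "u \<noteq> []" using False lu(1) by auto
      hence u: "u = h # t" unfolding h_def t_def wu by simp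
      hence hx: "h \<noteq> x" using d(1) by auto
      have ev: "even (length v)" "even (length t)"
        using False lu arg_cong[OF u, of length] by (auto, presburger)
      \<comment> \<open>The two sides of \<open>x\<close> are glued together at the high point \<open>h\<close>, where the cycle was cut.\<close>
      have "zigzag (x # l) (w @ [h]) \<longleftrightarrow> zigzag l (v @ u)" for l
      proof -
        have "zigzag (x # l) (w @ [h]) \<longleftrightarrow> zigzag l u \<and> zigzag l (v @ [h])"
          using zigzag_Cons_low[of u "v @ [h]" x l] False lu d hx by (auto simp: wu)
        also have "\<dots> \<longleftrightarrow> zigzag l (v @ u)"
          using zigzag_append[of "v @ [h]" l t] ev by (auto simp: u)
        finally show ?thesis .
      qed
      hence "f i = measure_pmf.prob (perm_pmf (set w - {x})) {l. zigzag l (v @ u)}"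
        by (simp add: f_def x_def h_def)
      also have "\<dots> = zigzag_prob n"
        by (rule prob_zigzag) (use d lu in \<open>auto simp: wu\<close>)
      finally show ?thesis using False by simp
    qed
  qed
  have s: "set (w @ [hd w]) = set w" using w(1) by (cases w) auto
  have "measure_pmf.prob (perm_pmf A) {l. zigzag l (w @ [hd w])} =
      measure_pmf.prob (perm_pmf (set w)) {l. zigzag l (w @ [hd w])}"
    using prob_zigzag_set[of A "w @ [hd w]"] assms s by metis
  also have "\<dots> = (\<Sum>x\<in>set w. measure_pmf.prob (perm_pmf (set w - {x}))
      {l. zigzag (x # l) (w @ [hd w])}) / (2 * n + 2)"
    using w by (subst perm_pmf_first) auto
  also have "(\<Sum>x\<in>set w. measure_pmf.prob (perm_pmf (set w - {x}))
      {l. zigzag (x # l) (w @ [hd w])}) = (\<Sum>i<2 * n + 2. f i)"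
    unfolding f_def
    by (rule sum.reindex_bij_betw[symmetric, OF bij_betw_nth]) (use assms in auto)
  also have "\<dots> = (\<Sum>i<2 * n + 2. if even i then 0 else zigzag_prob n)"
    by (intro sum.cong refl f) simp
  also have "\<dots> = (n + 1) * zigzag_prob n"
  proof -
    have "(\<Sum>i<2 * m. if even i then 0 else c) = m * c" for m :: nat and c :: real
      by (induction m) (simp_all add: algebra_simps)
    from this[of "zigzag_prob n" "n + 1"] show ?thesis by simp
  qed
  also have "(n + 1) * zigzag_prob n / (2 * n + 2) = zigzag_prob n / 2"
    by (simp add: divide_simps)
  finally show ?thesis .
qed

section \<open>The order of first hits\<close>

text \<open>The condition \<open>n \<ge> 1\<close> reflects that the value at time 0 does not produce a step. Site \<open>b\<close> may
  never be hit at all.\<close>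
definition hits_before :: "(nat \<Rightarrow> nat) \<Rightarrow> nat \<Rightarrow> nat \<Rightarrow> bool" where
  "hits_before x a b \<longleftrightarrow> (\<exists>n\<ge>1. x n = a \<and> (\<forall>m\<in>{1..n}. x m \<noteq> b))"

lemma hits_before_asym: "hits_before x a b \<Longrightarrow> \<not> hits_before x b a"
  unfolding hits_before_def by (metis atLeastAtMost_iff linorder_linear)

lemma hits_before_irrefl: "\<not> hits_before x a a"
  using hits_before_asym by blast

text \<open>This is how an order that lists the sites by first hit encodes the comparison of first hits.\<close>
lemma precedes_iff_hits_before:
  assumes "sorted_wrt (hits_before x) l" "a \<in> set l" "b \<in> set l"
  shows "precedes l a b \<longleftrightarrow> hits_before x a b"
  using assms by (induction l) (auto simp: hits_before_irrefl dest: hits_before_asym)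

lemma sorted_wrt_asym_unique:
  assumes "\<And>a b. R a b \<Longrightarrow> \<not> R b a"
    and "sorted_wrt R l" "sorted_wrt R l'" "set l = set l'"
  shows "l = l'"
  using assms(2-4)
proof (induction l arbitrary: l')
  case (Cons a l l')
  then obtain b l'' where l': "l' = b # l''" by (cases l') auto
  have "a = b"
  proof (rule ccontr)
    assume "a \<noteq> b"
    hence "R a b" "R b a" using Cons.prems unfolding l' by auto
    thus False using assms(1) by blast
  qed
  moreover have "a \<notin> set l" "b \<notin> set l''"
    using Cons.prems assms(1)[of a a] assms(1)[of b b] unfolding l' by auto
  ultimately have "set l = set l''"
    using Cons.prems(3) insert_ident[of a "set l" "set l''"] by (simp add: l')
  hence "l = l''"
    using Cons.IH[of l''] Cons.prems(1,2) by (simp add: l')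
  with \<open>a = b\<close> show ?case by (simp add: l')
qed auto

lemma first_hit_order_exists:
  assumes "\<forall>k\<in>{1..K}. \<exists>n\<ge>1. x n = k"
  shows "\<exists>l\<in>permutations_of_set {1..K}. sorted_wrt (hits_before x) l"
proof -
  define T where "T k = (LEAST n. n \<ge> 1 \<and> x n = k)" for k
  have T: "T k \<ge> 1 \<and> x (T k) = k" if "k \<in> {1..K}" for k
    unfolding T_def by (rule LeastI_ex) (use assms that in auto)
  have before: "hits_before x a b" if "a \<in> {1..K}" "T a \<le> T b" "a \<noteq> b" for a b
  proof -
    have "x m \<noteq> b" if m: "m \<in> {1..T a}" for m
    proof
      assume "x m = b"
      hence "T b \<le> m" unfolding T_def using m by (intro Least_le) auto
      hence "m = T a" using m \<open>T a \<le> T b\<close> by auto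
      thus False using T[OF \<open>a \<in> {1..K}\<close>] \<open>x m = b\<close> \<open>a \<noteq> b\<close> by simp
    qed
    thus ?thesis unfolding hits_before_def using T[OF that(1)] by blast
  qed
  define l where "l = sort_key T [1..<Suc K]"
  have l: "set l = {1..K}" "distinct l" "sorted (map T l)"
    by (auto simp: l_def)
  have "sorted_wrt (hits_before x) l"
    unfolding sorted_wrt_iff_nth_less
  proof (intro allI impI)
    fix i j assume ij: "i < j" "j < length l"
    have "l ! i \<in> {1..K}" using ij l(1) nth_mem[of i l] by simp
    moreover have "T (l ! i) \<le> T (l ! j)"
      using l(3) ij by (simp add: sorted_wrt_iff_nth_less sorted_wrt_map)
    moreover have "l ! i \<noteq> l ! j" using l(2) ij by (simp add: nth_eq_iff_index_eq)
    ultimately show "hits_before x (l ! i) (l ! j)" by (rule before)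
  qed
  thus ?thesis using l by (intro bexI[of _ l]) auto
qed

section \<open>Roots are local minima of the first hits\<close>

lemma height_eq_0_iff: "height K x n k = 0 \<longleftrightarrow> (\<forall>m\<in>{1..n}. x m \<noteq> k)"
  by (induction n) (auto simp: atLeastAtMostSuc_conv)

lemma finite_nbrs: "finite (nbrs K k)" and nbrs_self: "k \<in> nbrs K k"
  by (auto simp: nbrs_def)

lemma Max_eq_0_iff_nat:
  "finite A \<Longrightarrow> A \<noteq> {} \<Longrightarrow> Max A = 0 \<longleftrightarrow> (\<forall>a\<in>A. a = (0::nat))"
  by (metis Max_in Max_ge le_zero_eq)

text \<open>Since \<open>k\<close> belongs to its own neighbour set, a step at \<open>k\<close> gives height 1 exactly when all
  heights in this set are still 0, that is, when none of these sites has been hit.\<close>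
lemma height_eq_1_iff:
  "(\<exists>i\<ge>1. height K x i k = 1) \<longleftrightarrow>
    (\<exists>n\<ge>1. x n = k \<and> (\<forall>j\<in>nbrs K k. \<forall>m\<in>{1..<n}. x m \<noteq> j))" (is "?L \<longleftrightarrow> ?R")
proof
  have step: "height K x (Suc n) k = 1 \<longleftrightarrow> (\<forall>j\<in>nbrs K k. \<forall>m\<in>{1..<Suc n}. x m \<noteq> j)"
    if "x (Suc n) = k" for n
  proof -
    have "height K x (Suc n) k = 1 \<longleftrightarrow> Max (height K x n ` nbrs K k) = 0"
      using that by simp
    also have "\<dots> \<longleftrightarrow> (\<forall>j\<in>nbrs K k. height K x n j = 0)"
      using nbrs_self[of k K] finite_nbrs[of K k] by (subst Max_eq_0_iff_nat) auto
    finally show ?thesis by (simp add: height_eq_0_iff atLeastLessThanSuc_atLeastAtMost)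
  qed
  show ?R if ?L
  proof -
    have "height K x i k = 1 \<Longrightarrow> ?R" for i
    proof (induction i)
      case (Suc i)
      show ?case
      proof (cases "x (Suc i) = k")
        case True
        with Suc.prems step[OF True] show ?thesis by (intro exI[of _ "Suc i"]) simp
      qed (use Suc in simp)
    qed simp
    with that show ?thesis by blast
  qed
  show ?L if ?R
  proof -
    from that obtain n where n: "n \<ge> 1" "x n = k" "\<forall>j\<in>nbrs K k. \<forall>m\<in>{1..<n}. x m \<noteq> j"
      by blast
    then obtain n' where "n = Suc n'" by (cases n) auto
    with n step[of n'] show ?thesis by (intro exI[of _ n]) simp
  qed
qed

text \<open>The time at which \<open>k\<close> attains height 1 is its first hit. The hypothesis excludes a strip
  without proper neighbours, where the right-hand side would not force \<open>k\<close> to be hit.\<close>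
lemma roots_iff:
  assumes "nbrs K k - {k} \<noteq> {}"
  shows "k \<in> roots K x \<longleftrightarrow> k \<in> {1..K} \<and> (\<forall>j\<in>nbrs K k - {k}. hits_before x k j)"
proof -
  have "(\<exists>n\<ge>1. x n = k \<and> (\<forall>j\<in>nbrs K k. \<forall>m\<in>{1..<n}. x m \<noteq> j)) \<longleftrightarrow>
    (\<forall>j\<in>nbrs K k - {k}. hits_before x k j)" (is "?L \<longleftrightarrow> ?R")
  proof
    assume ?L
    then obtain n where n: "n \<ge> 1" "x n = k" "\<And>j m. j \<in> nbrs K k \<Longrightarrow> m \<in> {1..<n} \<Longrightarrow> x m \<noteq> j"
      by blast
    show ?R
    proof
      fix j assume j: "j \<in> nbrs K k - {k}"
      have "x m \<noteq> j" if "m \<in> {1..n}" for m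
        using n(2) n(3)[of j m] j that by (cases "m = n") auto
      thus "hits_before x k j" unfolding hits_before_def using n(1,2) by blast
    qed
  next
    assume R: ?R
    define n where "n = (LEAST n. n \<ge> 1 \<and> x n = k)"
    have ex: "\<exists>n. n \<ge> 1 \<and> x n = k" using R assms unfolding hits_before_def by blast
    have n: "n \<ge> 1" "x n = k" using LeastI_ex[OF ex] unfolding n_def by auto
    have "x m \<noteq> j" if j: "j \<in> nbrs K k" and m: "m \<in> {1..<n}" for j m
    proof (cases "j = k")
      case True
      show ?thesis using not_less_Least[of m "\<lambda>n. n \<ge> 1 \<and> x n = k"] m True
        unfolding n_def by auto
    next
      case False
      then obtain n1 where n1: "n1 \<ge> 1" "x n1 = k" "\<forall>m\<in>{1..n1}. x m \<noteq> j"
        using R j unfolding hits_before_def by blast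
      have "n \<le> n1" unfolding n_def using n1 by (intro Least_le) simp
      thus ?thesis using n1(3) m by simp
    qed
    thus ?L using n by blast
  qed
  thus ?thesis unfolding roots_def by (auto simp: height_eq_1_iff simp del: One_nat_def)
qed

section \<open>Cyclic coordinates\<close>

text \<open>Indexing the strip by residues modulo \<open>K\<close>, with all natural numbers as representatives, makes
  the neighbour relation translation invariant and avoids case distinctions at the ends.\<close>
definition site :: "nat \<Rightarrow> nat \<Rightarrow> nat" where
  "site K i = i mod K + 1"

lemma site_range: "K > 0 \<Longrightarrow> site K i \<in> {1..K}"
  using mod_less_divisor[of K i] by (auto simp: site_def Suc_le_eq)

lemma site_add_period: "site K (i + K) = site K i"
  by (simp add: site_def)

lemma mod_add_left_cancel_less:
  fixes k i j K :: nat
  assumes "i < K" "j < K" "(k + i) mod K = (k + j) mod K"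
  shows "i = j"
proof -
  have "\<not> i < j" if "(k + i) mod K = (k + j) mod K" "j < K" for i j
  proof
    assume "i < j"
    hence "K dvd j - i" using that mod_eq_dvd_iff_nat[of "k + i" "k + j" K] by simp
    thus False using \<open>i < j\<close> \<open>j < K\<close> dvd_imp_le[of K "j - i"] by simp
  qed
  from this[of i j] this[of j i] assms show ?thesis by simp
qed

text \<open>Any \<open>K\<close> consecutive indices address different sites.\<close>
lemma inj_site: "inj_on (\<lambda>i. site K (k + i)) {..<K}"
  by (auto simp: inj_on_def site_def dest: mod_add_left_cancel_less)

lemma nbrs_site:
  assumes "K \<ge> 3"
  shows "nbrs K (site K (i + 1)) - {site K (i + 1)} = {site K i, site K (i + 2)}"
proof -
  define r where "r = i mod K"
  have r: "r < K" using assms by (simp add: r_def)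
  have s: "site K i = r + 1" "site K (i + 1) = (r + 1) mod K + 1" "site K (i + 2) = (r + 2) mod K + 1"
    by (simp_all add: site_def r_def mod_simps)
  consider "r + 1 = K" | "r + 2 = K" | "r + 2 < K" using r by linarith
  thus ?thesis
  proof cases
    case 1
    hence "r + 2 = K + 1" by simp
    hence "(r + 1) mod K = 0" "(r + 2) mod K = 1"
      using 1 assms by (simp_all add: mod_Suc)
    with 1 assms show ?thesis unfolding s by (auto simp: nbrs_def)
  next
    case 2
    hence "(r + 1) mod K = r + 1" "(r + 2) mod K = 0" by auto
    with 2 assms show ?thesis unfolding s by (auto simp: nbrs_def)
  next
    case 3
    with assms show ?thesis unfolding s by (auto simp: nbrs_def)
  qed
qed

lemma site_in_roots_iff:
  assumes "K \<ge> 3"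
  shows "site K (i + 1) \<in> roots K x \<longleftrightarrow>
    hits_before x (site K (i + 1)) (site K i) \<and> hits_before x (site K (i + 1)) (site K (i + 2))"
proof -
  have "site K (i + 1) \<in> {1..K}" using assms by (intro site_range) simp
  thus ?thesis using roots_iff[of K "site K (i + 1)" x] unfolding nbrs_site[OF assms] by blast
qed

section \<open>Gaps of size one as a cyclic count\<close>

text \<open>If no two elements are adjacent, then \<open>k\<close> and \<open>k + 2\<close> are consecutive as soon as both
  are present.\<close>
lemma sum_consecutive_gap2:
  fixes xs :: "nat list"
  assumes "sorted_wrt (<) xs" "\<And>k. k \<in> set xs \<Longrightarrow> k + 1 \<notin> set xs"
  shows "(\<Sum>j = 1..length xs - 1. of_bool (xs ! j - xs ! (j - 1) = 2)) =
    card {k \<in> set xs. k + 2 \<in> set xs}"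
proof -
  have less: "xs ! i < xs ! j \<longleftrightarrow> i < j" if "i < length xs" "j < length xs" for i j
    using assms(1) that unfolding sorted_wrt_iff_nth_less
    by (metis linorder_neqE_nat order_less_imp_not_less)
  have "(\<Sum>j = 1..length xs - 1. of_bool (xs ! j - xs ! (j - 1) = 2)) =
    card {j \<in> {1..length xs - 1}. xs ! j - xs ! (j - 1) = 2}"
    by (simp add: sum.If_cases of_bool_def Int_def)
  also have "\<dots> = card {k \<in> set xs. k + 2 \<in> set xs}"
  proof (rule bij_betw_same_card)
    show "bij_betw (\<lambda>j. xs ! (j - 1)) {j \<in> {1..length xs - 1}. xs ! j - xs ! (j - 1) = 2}
      {k \<in> set xs. k + 2 \<in> set xs}"
      unfolding bij_betw_def
    proof (intro conjI equalityI subsetI)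
      show "inj_on (\<lambda>j. xs ! (j - 1)) {j \<in> {1..length xs - 1}. xs ! j - xs ! (j - 1) = 2}"
      proof (rule inj_onI)
        fix i j assume "i \<in> {j \<in> {1..length xs - 1}. xs ! j - xs ! (j - 1) = 2}"
          "j \<in> {j \<in> {1..length xs - 1}. xs ! j - xs ! (j - 1) = 2}"
          and eq: "xs ! (i - 1) = xs ! (j - 1)"
        hence "i \<ge> 1" "j \<ge> 1" "i - 1 < length xs" "j - 1 < length xs" by auto
        moreover from this eq have "i - 1 = j - 1"
          using less[of "i - 1" "j - 1"] less[of "j - 1" "i - 1"] by simp
        ultimately show "i = j" by simp
      qed
    next
      fix k assume "k \<in> (\<lambda>j. xs ! (j - 1)) ` {j \<in> {1..length xs - 1}. xs ! j - xs ! (j - 1) = 2}"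
      then obtain j where j: "j \<ge> 1" "j < length xs" "xs ! j - xs ! (j - 1) = 2" "k = xs ! (j - 1)"
        by auto
      hence "xs ! j = k + 2" by simp
      moreover have "k \<in> set xs" "xs ! j \<in> set xs" using j by auto
      ultimately show "k \<in> {k \<in> set xs. k + 2 \<in> set xs}" by simp
    next
      fix k assume "k \<in> {k \<in> set xs. k + 2 \<in> set xs}"
      then obtain i j where ij: "i < length xs" "xs ! i = k" "j < length xs" "xs ! j = k + 2"
        by (auto simp: in_set_conv_nth)
      have "i < j" using less[of i j] ij by simp
      have "j = i + 1"
      proof (rule ccontr)
        assume "j \<noteq> i + 1"
        hence "i + 1 < j" using \<open>i < j\<close> by simp
        hence "xs ! i < xs ! (i + 1)" "xs ! (i + 1) < xs ! j" "i + 1 < length xs"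
          using less[of i "i + 1"] less[of "i + 1" j] ij by auto
        hence "xs ! (i + 1) = k + 1" "i + 1 < length xs" using ij by auto
        thus False using assms(2)[of k] ij nth_mem by metis
      qed
      thus "k \<in> (\<lambda>j. xs ! (j - 1)) ` {j \<in> {1..length xs - 1}. xs ! j - xs ! (j - 1) = 2}"
        using ij by (intro image_eqI[of _ _ j]) auto
    qed
  qed
  finally show ?thesis .
qed

text \<open>The last summand of \<^const>\<open>num_gaps\<close> is the gap across the end of the strip. The largest and
  the smallest root differ by \<open>K - 2\<close> precisely for the pairs \<open>(K - 1, 1)\<close> and \<open>(K, 2)\<close>, since
  \<open>K\<close> and \<open>1\<close> are adjacent and cannot both be roots; these are the two pairs of the cyclic count that
  wrap around. For \<open>K = 4\<close> the pair of roots is counted once in each direction.\<close>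
lemma num_gaps_1_eq:
  assumes K: "K \<ge> 4" and ne: "roots K x \<noteq> {}"
    and adj: "\<And>i. site K i \<in> roots K x \<Longrightarrow> site K (i + 1) \<notin> roots K x"
  shows "num_gaps 1 K x = (\<Sum>i<K. of_bool (site K i \<in> roots K x \<and> site K (i + 2) \<in> roots K x))"
proof -
  define R where "R = roots K x"
  define xs where "xs = sorted_list_of_set R"
  have R: "R \<subseteq> {1..K}" "finite R" "R \<noteq> {}"
    using ne by (auto simp: R_def roots_def intro: finite_subset[of _ "{1..K}"])
  have lin: "k + 1 \<notin> R" if "k \<in> R" for k
  proof
    assume "k + 1 \<in> R"
    with that R have "1 \<le> k" "k < K" by auto
    hence "site K (k - 1) = k" "site K (k - 1 + 1) = k + 1" by (auto simp: site_def)
    thus False using adj[of "k - 1"] that \<open>k + 1 \<in> R\<close> by (metis R_def)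
  qed
  have cyc: "1 \<notin> R" if "K \<in> R"
  proof -
    have "site K (K - 1) = K" "site K (K - 1 + 1) = 1" using K by (auto simp: site_def)
    thus ?thesis using adj[of "K - 1"] that by (metis R_def)
  qed
  have xs: "set xs = R" "sorted_wrt (<) xs" "length xs = card R" "xs \<noteq> []"
    using R by (auto simp: xs_def)
  have "xs ! 0 \<in> R" "xs ! (card R - 1) \<in> R"
    using xs R(3) R(2) by (auto simp: card_gt_0_iff simp flip: xs(1,3))
  moreover have "xs ! 0 \<le> y \<and> y \<le> xs ! (card R - 1)" if "y \<in> R" for y
  proof -
    have "sorted xs" by (simp add: xs_def)
    moreover obtain i where "i < length xs" "y = xs ! i"
      using \<open>y \<in> R\<close> xs(1) by (auto simp: in_set_conv_nth)
    ultimately show ?thesis using xs(3) by (auto intro!: sorted_nth_mono)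
  qed
  ultimately have ends: "xs ! 0 = Min R" "xs ! (card R - 1) = Max R"
    using R(2) by (auto intro!: Min_eqI[symmetric] Max_eqI[symmetric])
  have last: "(Max R - Min R = K - 2) \<longleftrightarrow> (1 \<in> R \<and> K - 1 \<in> R) \<or> (2 \<in> R \<and> K \<in> R)"
    (is "?L \<longleftrightarrow> ?A")
  proof
    have M: "Min R \<in> R" "Max R \<in> R" "Min R \<ge> 1" "Max R \<le> K"
      using R Min_in[of R] Max_in[of R] by auto
    assume ?L
    hence "Min R = 1 \<and> Max R = K - 1 \<or> Min R = 2 \<and> Max R = K \<or> Min R = 1 \<and> Max R = K"
      using M K by auto
    thus ?A using M cyc by metis
  next
    assume ?A
    thus ?L
    proof
      assume A: "1 \<in> R \<and> K - 1 \<in> R"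
      hence "K \<notin> R" using cyc by auto
      have "Min R = 1" using R A by (intro Min_eqI) auto
      moreover have "Max R = K - 1"
      proof (rule Max_eqI)
        fix y assume "y \<in> R"
        hence "y \<noteq> K" "y \<le> K" using \<open>K \<notin> R\<close> R by auto
        thus "y \<le> K - 1" by simp
      qed (use R A in auto)
      ultimately show ?L by simp
    next
      assume A: "2 \<in> R \<and> K \<in> R"
      hence "1 \<notin> R" using cyc by auto
      have "Max R = K" using R A by (intro Max_eqI) auto
      moreover have "Min R = 2"
      proof (rule Min_eqI)
        fix y assume "y \<in> R"
        hence "y \<noteq> 1" "y \<ge> 1" using \<open>1 \<notin> R\<close> R by auto
        thus "2 \<le> y" by simp
      qed (use R A in auto)
      ultimately show ?L by simp
    qed
  qed
  have excl: "\<not> ((1 \<in> R \<and> K - 1 \<in> R) \<and> (2 \<in> R \<and> K \<in> R))" using cyc by blast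
  have "num_gaps 1 K x = (\<Sum>j = 1..card R - 1. of_bool (xs ! j - xs ! (j - 1) = 2)) +
      of_bool (Max R - Min R = K - 2)"
    by (simp add: num_gaps_def root_at_def Let_def R_def[symmetric] xs_def[symmetric] ends
        ends(1)[unfolded One_nat_def] ends(2)[unfolded One_nat_def] numeral_2_eq_2)
  also have "(\<Sum>j = 1..card R - 1. of_bool (xs ! j - xs ! (j - 1) = 2)) = card {k \<in> R. k + 2 \<in> R}"
    using sum_consecutive_gap2[of xs] xs lin by simp
  also have "card {k \<in> R. k + 2 \<in> R} = (\<Sum>i<K - 2. of_bool (i + 1 \<in> R \<and> i + 3 \<in> R))"
  proof -
    have "{k \<in> R. k + 2 \<in> R} = Suc ` {i. i < K - 2 \<and> i + 1 \<in> R \<and> i + 3 \<in> R}"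
    proof (intro equalityI subsetI)
      fix k assume k: "k \<in> {k \<in> R. k + 2 \<in> R}"
      hence "1 \<le> k" "k + 2 \<le> K" using R by auto
      thus "k \<in> Suc ` {i. i < K - 2 \<and> i + 1 \<in> R \<and> i + 3 \<in> R}"
        using k by (intro image_eqI[of _ _ "k - 1"]) (auto simp: Suc_diff_le numeral_eq_Suc)
    qed (auto simp: numeral_eq_Suc)
    thus ?thesis
      by (simp add: card_image sum.If_cases of_bool_def Int_def)
  qed
  also have "of_bool (Max R - Min R = K - 2) =
      of_bool (K - 1 \<in> R \<and> 1 \<in> R) + (of_bool (K \<in> R \<and> 2 \<in> R) :: nat)"
    unfolding last using excl by auto
  also have "(\<Sum>i<K - 2. of_bool (i + 1 \<in> R \<and> i + 3 \<in> R)) +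
      (of_bool (K - 1 \<in> R \<and> 1 \<in> R) + of_bool (K \<in> R \<and> 2 \<in> R)) =
      (\<Sum>i<K. of_bool (site K i \<in> R \<and> site K (i + 2) \<in> R) :: nat)"
  proof -
    define m where "m = K - 2"
    have m: "K = m + 2" "m \<ge> 2" using K by (auto simp: m_def)
    have "(\<Sum>i<m. of_bool (i + 1 \<in> R \<and> i + 3 \<in> R)) =
      (\<Sum>i<m. of_bool (site K i \<in> R \<and> site K (i + 2) \<in> R) :: nat)"
      by (intro sum.cong) (auto simp: m(1) site_def numeral_3_eq_3)
    moreover have "site K m = K - 1" "site K (m + 2) = 1" "site K (m + 1) = K" "site K (m + 1 + 2) = 2"
      using m(2) unfolding m(1) by (auto simp: site_def mod_Suc)
    moreover have "{..<K} = insert (m + 1) (insert m {..<m})" "K - 2 = m"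
      using m by auto
    ultimately show ?thesis by simp
  qed
  finally show ?thesis by (simp add: R_def)
qed

section \<open>Uniformity of the order of first hits\<close>

lemma distr_uniform_count_measure_permutes:
  assumes "finite A" "\<pi> permutes A"
  shows "distr (uniform_count_measure A) (count_space A) \<pi> = uniform_count_measure A"
proof (rule measure_eqI)
  fix B assume "B \<in> sets (distr (uniform_count_measure A) (count_space A) \<pi>)"
  hence B: "B \<subseteq> A" by simp
  have "\<pi> -` B \<inter> A = inv \<pi> ` B"
    using permutes_vimage[OF assms(2)] B permutes_image[OF permutes_inv[OF assms(2)]]
    by (auto simp: bij_image_Collect_eq permutes_inverses[OF assms(2)] image_iff permutes_in_image[OF assms(2)]
        intro!: bexI[of _ "\<pi> _"])
  hence c: "card (\<pi> -` B \<inter> A) = card B"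
    using assms(2) by (metis card_image inj_on_subset permutes_inj permutes_inv subset_UNIV)
  have m: "\<pi> \<in> uniform_count_measure A \<rightarrow>\<^sub>M count_space A"
    using assms(2) by (auto simp: measurable_def space_uniform_count_measure
        sets_uniform_count_measure permutes_in_image)
  show "emeasure (distr (uniform_count_measure A) (count_space A) \<pi>) B =
      emeasure (uniform_count_measure A) B"
    using B assms(1) c by (subst emeasure_distr[OF m])
      (auto simp: space_uniform_count_measure emeasure_uniform_count_measure)
qed (simp add: sets_uniform_count_measure)

text \<open>The site set is written \<open>{1..K}\<close> inside measure spaces; rewriting its lower end to
  \<^term>\<open>Suc 0\<close> would hide it from the facts about these spaces.\<close>
declare One_nat_def [simp del]

locale uniform_site_sequence = prob_space M for M :: "'a measure" +
  fixes K :: nat and X :: "nat \<Rightarrow> 'a \<Rightarrow> nat"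
  assumes K_pos: "K > 0"
    and indep: "indep_vars (\<lambda>_. count_space {1..K}) X UNIV"
    and uniform: "\<And>n. distr M (count_space {1..K}) (X n) = uniform_count_measure {1..K}"
begin

lemma X_measurable [measurable]: "X n \<in> M \<rightarrow>\<^sub>M count_space {1..K}"
  using indep by (simp add: indep_vars_def)

lemma X_in_sites: "\<omega> \<in> space M \<Longrightarrow> X n \<omega> \<in> {1..K}"
  using measurable_space[OF X_measurable] by (simp del: atLeastAtMost_iff)

text \<open>Both laws are products of uniform laws, and a permutation preserves the uniform law.\<close>
lemma distr_relabelled:
  assumes "\<pi> permutes {1..K}"
  shows "distr M (\<Pi>\<^sub>M n\<in>UNIV. count_space {1..K}) (\<lambda>\<omega> n. \<pi> (X n \<omega>)) =
    distr M (\<Pi>\<^sub>M n\<in>UNIV. count_space {1..K}) (\<lambda>\<omega> n. X n \<omega>)"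
proof -
  have pi: "\<pi> \<in> count_space {1..K} \<rightarrow>\<^sub>M count_space {1..K}"
    using permutes_in_image[OF assms] by (auto simp: measurable_def)
  have rv: "(\<lambda>\<omega>. \<pi> (X n \<omega>)) \<in> M \<rightarrow>\<^sub>M count_space {1..K}" for n
    using measurable_compose[OF X_measurable pi] .
  have "indep_vars (\<lambda>_. count_space {1..K}) (\<lambda>n \<omega>. \<pi> (X n \<omega>)) UNIV"
    by (rule indep_vars_compose2[OF indep]) (rule pi)
  hence "distr M (\<Pi>\<^sub>M n\<in>UNIV. count_space {1..K}) (\<lambda>\<omega> n. \<pi> (X n \<omega>)) =
    (\<Pi>\<^sub>M n\<in>UNIV. distr M (count_space {1..K}) (\<lambda>\<omega>. \<pi> (X n \<omega>)))"
    by (subst (asm) indep_vars_iff_distr_eq_PiM') (auto intro: rv simp: restrict_def)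
  also have "\<dots> = (\<Pi>\<^sub>M n\<in>UNIV. distr M (count_space {1..K}) (X n))"
  proof (intro PiM_cong refl)
    fix n :: nat
    have "distr M (count_space {1..K}) (\<lambda>\<omega>. \<pi> (X n \<omega>)) =
        distr (distr M (count_space {1..K}) (X n)) (count_space {1..K}) \<pi>"
      by (subst distr_distr[OF pi X_measurable]) (simp add: o_def)
    thus "distr M (count_space {1..K}) (\<lambda>\<omega>. \<pi> (X n \<omega>)) = distr M (count_space {1..K}) (X n)"
      unfolding uniform by (simp add: distr_uniform_count_measure_permutes[OF _ assms])
  qed
  also have "\<dots> = distr M (\<Pi>\<^sub>M n\<in>UNIV. count_space {1..K}) (\<lambda>\<omega> n. X n \<omega>)"
    using indep by (subst (asm) indep_vars_iff_distr_eq_PiM') (auto simp: restrict_def)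
  finally show ?thesis .
qed

lemma pred_hits_before:
  assumes "\<And>n. f n \<in> N \<rightarrow>\<^sub>M count_space {1..K}"
  shows "Measurable.pred N (\<lambda>\<omega>. hits_before (\<lambda>n. f n \<omega>) a b)"
proof -
  have [measurable]: "f n \<in> N \<rightarrow>\<^sub>M count_space UNIV" for n
    by (rule measurable_compose[OF assms]) simp
  show ?thesis unfolding hits_before_def by measurable
qed

lemma pred_first_hit_order:
  assumes "\<And>n. f n \<in> N \<rightarrow>\<^sub>M count_space {1..K}"
  shows "Measurable.pred N (\<lambda>\<omega>. sorted_wrt (hits_before (\<lambda>n. f n \<omega>)) l)"
proof -
  note pred_hits_before[OF assms, measurable]
  show ?thesis unfolding sorted_wrt_iff_nth_less by measurable
qed

definition order_event :: "nat list \<Rightarrow> 'a set" where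
  "order_event l = {\<omega> \<in> space M. sorted_wrt (hits_before (\<lambda>n. X n \<omega>)) l}"

lemma order_event_sets [measurable]: "order_event l \<in> events"
  using pred_first_hit_order[OF X_measurable, where l = l] by (simp add: order_event_def pred_def)

text \<open>Relabelling turns the event for \<open>l\<close> into the event for \<open>map \<pi> l\<close>, and it preserves the law of
  the sequence.\<close>
lemma prob_order_event_permute:
  assumes "\<pi> permutes {1..K}" "set l \<subseteq> {1..K}"
  shows "prob (order_event (map \<pi> l)) = prob (order_event l)"
proof -
  let ?P = "\<Pi>\<^sub>M n\<in>(UNIV :: nat set). count_space {1..K}"
  define E where "E = {x \<in> space ?P. sorted_wrt (hits_before x) (map \<pi> l)}"
  have E: "E \<in> sets ?P"
    using pred_first_hit_order[of "\<lambda>n x. x n" ?P "map \<pi> l"] unfolding E_def pred_def by simp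
  have pi: "\<pi> \<in> count_space {1..K} \<rightarrow>\<^sub>M count_space {1..K}"
    using permutes_in_image[OF assms(1)] by (auto simp: measurable_def)
  have m1: "(\<lambda>\<omega> n. X n \<omega>) \<in> M \<rightarrow>\<^sub>M ?P"
    by (rule measurable_PiM_single') (auto simp: X_in_sites[unfolded atLeastAtMost_iff])
  have m2: "(\<lambda>\<omega> n. \<pi> (X n \<omega>)) \<in> M \<rightarrow>\<^sub>M ?P"
    using permutes_in_image[OF assms(1)] X_in_sites
    by (intro measurable_PiM_single' measurable_compose[OF X_measurable pi])
       (auto simp del: atLeastAtMost_iff)
  have hb: "hits_before (\<lambda>n. \<pi> (x n)) (\<pi> a) (\<pi> b) \<longleftrightarrow> hits_before x a b" for x a b
    unfolding hits_before_def using inj_eq[OF permutes_inj[OF assms(1)]] by simp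
  have "prob (order_event (map \<pi> l)) = measure (distr M ?P (\<lambda>\<omega> n. X n \<omega>)) E"
    unfolding measure_distr[OF m1 E] using measurable_space[OF m1]
    by (intro arg_cong[of _ _ prob]) (auto simp: order_event_def E_def)
  also have "\<dots> = measure (distr M ?P (\<lambda>\<omega> n. \<pi> (X n \<omega>))) E"
    by (simp only: distr_relabelled[OF assms(1)])
  also have "\<dots> = prob (order_event l)"
    unfolding measure_distr[OF m2 E] using measurable_space[OF m2]
    by (intro arg_cong[of _ _ prob]) (auto simp: order_event_def E_def sorted_wrt_map hb)
  finally show ?thesis .
qed

lemma prob_X_avoids: "k \<in> {1..K} \<Longrightarrow> prob {\<omega> \<in> space M. X n \<omega> \<noteq> k} = 1 - 1 / K"
proof -
  assume k: "k \<in> {1..K}"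
  have "prob {\<omega> \<in> space M. X n \<omega> \<noteq> k} = prob (X n -` ({1..K} - {k}) \<inter> space M)"
    using X_in_sites by (intro arg_cong[of _ _ prob]) auto
  also have "\<dots> = measure (distr M (count_space {1..K}) (X n)) ({1..K} - {k})"
    by (subst measure_distr) auto
  also have "\<dots> = real (K - 1) / K"
    unfolding uniform using k by (subst measure_uniform_count_measure) auto
  finally show ?thesis using K_pos by (simp add: field_simps of_nat_diff)
qed

text \<open>Missing \<open>k\<close> during the first \<open>N\<close> steps has probability \<open>(1 - 1 / K) ^ N\<close>.\<close>
lemma AE_site_hit:
  assumes "k \<in> {1..K}"
  shows "AE \<omega> in M. \<exists>n\<ge>1. X n \<omega> = k"
proof -
  define A where "A = {\<omega> \<in> space M. \<forall>n\<ge>1. X n \<omega> \<noteq> k}"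
  have [measurable]: "X n \<in> M \<rightarrow>\<^sub>M count_space UNIV" for n
    by (rule measurable_compose[OF X_measurable]) simp
  have A: "A \<in> events" unfolding A_def by measurable
  have le: "prob A \<le> (1 - 1 / K) ^ N" for N
  proof (cases "N = 0")
    case False
    have "A \<subseteq> (\<Inter>n\<in>{1..N}. X n -` ({1..K} - {k}) \<inter> space M)"
      using X_in_sites by (auto simp: A_def simp del: One_nat_def)
    hence "prob A \<le> prob (\<Inter>n\<in>{1..N}. X n -` ({1..K} - {k}) \<inter> space M)"
      using False by (intro finite_measure_mono sets.finite_INT measurable_sets[OF X_measurable]) auto
    also have "\<dots> = (\<Prod>n\<in>{1..N}. prob (X n -` ({1..K} - {k}) \<inter> space M))"
      using False by (intro indep_varsD[OF indep]) auto
    also have "\<dots> = (\<Prod>n\<in>{1..N}. 1 - 1 / K)"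
    proof (intro prod.cong refl)
      fix n
      have "X n -` ({1..K} - {k}) \<inter> space M = {\<omega> \<in> space M. X n \<omega> \<noteq> k}"
        using X_in_sites by auto
      thus "prob (X n -` ({1..K} - {k}) \<inter> space M) = 1 - 1 / K"
        using prob_X_avoids[OF assms] by simp
    qed
    finally show ?thesis by simp
  qed simp
  have "(\<lambda>N. (1 - 1 / K) ^ N) \<longlonglongrightarrow> 0"
    using K_pos by (intro LIMSEQ_realpow_zero) (auto simp: field_simps)
  hence "prob A \<le> 0" by (rule LIMSEQ_le_const) (use le in blast)
  hence "prob A = 0" by (simp add: measure_le_0_iff)
  hence "AE \<omega> in M. \<omega> \<notin> A" using A by (simp add: prob_eq_0)
  thus ?thesis by (rule AE_mp) (auto simp: A_def)
qed

lemma order_events_disjoint: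
  assumes "l \<in> permutations_of_set {1..K}" "l' \<in> permutations_of_set {1..K}"
    "\<omega> \<in> order_event l" "\<omega> \<in> order_event l'"
  shows "l = l'"
proof (rule sorted_wrt_asym_unique)
  show "hits_before (\<lambda>n. X n \<omega>) a b \<Longrightarrow> \<not> hits_before (\<lambda>n. X n \<omega>) b a" for a b
    by (rule hits_before_asym)
  show "sorted_wrt (hits_before (\<lambda>n. X n \<omega>)) l" "sorted_wrt (hits_before (\<lambda>n. X n \<omega>)) l'"
    using assms(3,4) by (simp_all add: order_event_def)
  show "set l = set l'"
    using assms(1,2) by (simp add: permutations_of_set_def)
qed

lemma AE_order_event: "AE \<omega> in M. \<omega> \<in> (\<Union>l\<in>permutations_of_set {1..K}. order_event l)"
proof -
  have "AE \<omega> in M. \<forall>k\<in>{1..K}. \<exists>n\<ge>1. X n \<omega> = k"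
    by (rule AE_finite_allI) (simp, rule AE_site_hit)
  thus ?thesis
  proof (rule AE_mp, intro AE_I2 impI)
    fix \<omega> assume "\<omega> \<in> space M" "\<forall>k\<in>{1..K}. \<exists>n\<ge>1. X n \<omega> = k"
    with first_hit_order_exists[of K "\<lambda>n. X n \<omega>"]
    show "\<omega> \<in> (\<Union>l\<in>permutations_of_set {1..K}. order_event l)"
      unfolding order_event_def by blast
  qed
qed

text \<open>The \<open>K!\<close> order events are equally likely, disjoint, and cover the sample space up to a null
  set.\<close>
lemma prob_order_event:
  assumes l: "l \<in> permutations_of_set {1..K}"
  shows "prob (order_event l) = 1 / fact K"
proof -
  let ?S = "permutations_of_set {1..K}"
  have eq: "prob (order_event l') = prob (order_event l)" if l': "l' \<in> ?S" for l'
  proof -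
    \<comment> \<open>The permutation that sends each entry of \<open>l\<close> to the entry of \<open>l'\<close> at the same position.\<close>
    define f where "f = (\<lambda>x. if x \<in> {1..K} then the (map_of (zip l l') x) else x)"
    have len: "length l = length l'"
      using l l' by (simp add: length_finite_permutations_of_set)
    have d: "distinct l" "distinct l'" "set l = {1..K}" "set l' = {1..K}"
      using l l' by (auto simp: permutations_of_set_def)
    have fn: "f (l ! i) = l' ! i" if "i < length l" for i
    proof -
      have "l ! i \<in> {1..K}" using d(3) that nth_mem by blast
      moreover have "map_of (zip l l') (l ! i) = Some (l' ! i)"
        using that len d by (simp add: map_of_zip_nth)
      ultimately show ?thesis by (simp add: f_def)
    qed
    have mf: "map f l = l'" using fn len by (intro nth_equalityI) auto
    have "inj_on f {1..K}"
      using mf d by (metis distinct_map)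
    moreover have "f ` {1..K} = {1..K}" using mf d by (metis set_map)
    ultimately have "bij_betw f {1..K} {1..K}" by (simp add: bij_betw_def)
    hence "f permutes {1..K}" by (rule bij_imp_permutes) (auto simp: f_def)
    thus ?thesis using prob_order_event_permute[of f l] mf d by simp
  qed
  have "prob (\<Union>l\<in>?S. order_event l) = 1"
    using AE_order_event by (subst prob_eq_1) auto
  hence "1 = prob (\<Union>l\<in>?S. order_event l)" ..
  also have "\<dots> = (\<Sum>l'\<in>?S. prob (order_event l'))"
    using order_events_disjoint
    by (intro finite_measure_finite_Union) (auto simp: disjoint_family_on_def)
  also have "\<dots> = fact K * prob (order_event l)"
    by (simp add: eq)
  finally show ?thesis by (simp add: field_simps)
qed

text \<open>A random variable that is a function of the order of first hits may be integrated over the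
  uniform permutation instead. Its values outside the order events lie on a null set.\<close>
theorem expectation_first_hit_order:
  fixes f :: "'a \<Rightarrow> real"
  assumes "f \<in> borel_measurable M"
    and "\<And>\<omega> l. l \<in> permutations_of_set {1..K} \<Longrightarrow> \<omega> \<in> order_event l \<Longrightarrow> f \<omega> = g l"
  shows "expectation f = measure_pmf.expectation (perm_pmf {1..K}) g"
proof -
  let ?S = "permutations_of_set {1..K}"
  have "AE \<omega> in M. f \<omega> = (\<Sum>l\<in>?S. g l * indicator (order_event l) \<omega>)"
    using AE_order_event
  proof (rule AE_mp, intro AE_I2 impI)
    fix \<omega> assume "\<omega> \<in> (\<Union>l\<in>?S. order_event l)"
    then obtain l where l: "l \<in> ?S" "\<omega> \<in> order_event l" by blast
    have "(\<Sum>l'\<in>?S. g l' * indicator (order_event l') \<omega>) = (\<Sum>l'\<in>?S. if l' = l then g l else 0)"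
    proof (intro sum.cong refl)
      fix l' assume "l' \<in> ?S"
      hence "\<omega> \<in> order_event l' \<longleftrightarrow> l' = l" using l order_events_disjoint by blast
      thus "g l' * indicator (order_event l') \<omega> = (if l' = l then g l else 0)"
        by (simp add: indicator_def)
    qed
    thus "f \<omega> = (\<Sum>l\<in>?S. g l * indicator (order_event l) \<omega>)"
      using assms(2)[OF l] l(1) by simp
  qed
  hence "expectation f = (\<integral>\<omega>. (\<Sum>l\<in>?S. g l * indicator (order_event l) \<omega>) \<partial>M)"
    by (intro integral_cong_AE assms(1) borel_measurable_sum borel_measurable_times
        borel_measurable_indicator borel_measurable_const order_event_sets)
  also have "\<dots> = (\<Sum>l\<in>?S. g l * prob (order_event l))"
    by (subst Bochner_Integration.integral_sum) (auto simp: less_top[symmetric])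
  also have "\<dots> = measure_pmf.expectation (perm_pmf {1..K}) g"
    by (simp add: integral_pmf_of_set prob_order_event sum_divide_distrib)
  finally show ?thesis .
qed

end

declare One_nat_def [simp]

text \<open>Sums of indicators are kept as sums, for linearity of the expectation; they would otherwise
  turn into cardinalities.\<close>
declare sum_of_bool_eq [simp del]

section \<open>Roots as zigzags on consecutive sites\<close>

definition window :: "nat \<Rightarrow> nat \<Rightarrow> nat \<Rightarrow> nat list" where
  "window K m k = map (\<lambda>i. site K (k + i)) [0..<m]"

lemma window_Suc: "window K (Suc m) k = site K k # window K m (k + 1)"
  unfolding window_def map_upt_Suc by simp

lemma length_window: "length (window K m k) = m"
  by (simp add: window_def)

lemma set_window: "set (window K m k) = (\<lambda>i. site K (k + i)) ` {..<m}"
  by (simp add: window_def atLeast0LessThan)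

lemma set_window_subset: "K > 0 \<Longrightarrow> set (window K m k) \<subseteq> {1..K}"
  unfolding set_window using site_range by blast

lemma distinct_window: "m \<le> K \<Longrightarrow> distinct (window K m k)"
  unfolding window_def distinct_map
  by (auto intro: inj_on_subset[OF inj_site])

lemma window_wrap: "K > 0 \<Longrightarrow> window K (K + 1) k = window K K k @ [hd (window K K k)]"
  by (simp add: window_def hd_map site_add_period)

text \<open>In terms of the order \<open>l\<close> of first hits, this says that the site with index \<open>k + 1\<close> is a root.
  The index is shifted so that the three sites involved start at \<open>k\<close>.\<close>
definition root_after :: "nat \<Rightarrow> nat list \<Rightarrow> nat \<Rightarrow> bool" where
  "root_after K l k \<longleftrightarrow> precedes l (site K (k + 1)) (site K k) \<and> precedes l (site K (k + 1)) (site K (k + 2))"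

lemma root_after_add_period: "root_after K l (k + K) = root_after K l k"
  using site_add_period[of K k] site_add_period[of K "k + 1"] site_add_period[of K "k + 2"]
  by (simp add: root_after_def ac_simps)

lemma not_root_after_Suc: "root_after K l k \<Longrightarrow> \<not> root_after K l (k + 1)"
  using precedes_asym[of l "site K (k + 1)" "site K (k + 2)"] by (auto simp: root_after_def)

lemma zigzag_window: "zigzag l (window K (2 * n + 1) k) \<longleftrightarrow> (\<forall>j<n. root_after K l (k + 2 * j))"
proof (induction n arbitrary: k)
  case 0
  show ?case by (simp add: window_def)
next
  case (Suc n)
  have "window K (2 * Suc n + 1) k = site K k # site K (k + 1) # window K (2 * n + 1) (k + 2)"
    by (simp add: window_Suc)
  moreover have "window K (2 * n + 1) (k + 2) = site K (k + 2) # window K (2 * n) (k + 3)"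
    by (simp add: window_Suc numeral_3_eq_3)
  ultimately have "zigzag l (window K (2 * Suc n + 1) k) \<longleftrightarrow>
      root_after K l k \<and> zigzag l (window K (2 * n + 1) (k + 2))"
    by (simp add: root_after_def del: add_2_eq_Suc')
  also have "\<dots> \<longleftrightarrow> (\<forall>j<Suc n. root_after K l (k + 2 * j))"
    unfolding Suc.IH All_less_Suc2 by (simp add: algebra_simps)
  finally show ?case .
qed

abbreviation order_prob :: "nat \<Rightarrow> (nat list \<Rightarrow> bool) \<Rightarrow> real" where
  "order_prob K P \<equiv> measure_pmf.prob (perm_pmf {1..K}) {l. P l}"

lemma prob_alternating_roots:
  assumes "2 * n + 1 \<le> K"
  shows "order_prob K (\<lambda>l. \<forall>j<n. root_after K l (k + 2 * j)) = zigzag_prob n"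
  unfolding zigzag_window[symmetric] using assms
  by (intro prob_zigzag distinct_window set_window_subset) (simp_all add: length_window)

lemma prob_alternating_roots_cyclic:
  assumes "K = 2 * n + 2"
  shows "order_prob K (\<lambda>l. \<forall>j<n + 1. root_after K l (k + 2 * j)) = zigzag_prob n / 2"
proof -
  have "window K (2 * (n + 1) + 1) k = window K K k @ [hd (window K K k)]"
    using window_wrap[of K k] assms by simp
  thus ?thesis
    unfolding zigzag_window[symmetric] using assms
    by (simp only:, intro prob_cyclic_zigzag distinct_window set_window_subset)
       (simp_all add: length_window)
qed

section \<open>Moments of the number of close pairs of roots\<close>

text \<open>The sites with indices \<open>k + 1\<close> and \<open>k + 3\<close> are roots: one pair of roots at distance 1.\<close>
definition close_pair :: "nat \<Rightarrow> nat list \<Rightarrow> nat \<Rightarrow> bool" where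
  "close_pair K l k \<longleftrightarrow> root_after K l k \<and> root_after K l (k + 2)"

lemma close_pair_add_period: "close_pair K l (k + K) = close_pair K l k"
  using root_after_add_period[of K l k] root_after_add_period[of K l "k + 2"] by (simp add: close_pair_def ac_simps)

lemma all_less_numeral_simps:
  "(\<forall>j<2. P j) \<longleftrightarrow> P 0 \<and> P (1::nat)"
  "(\<forall>j<3. P j) \<longleftrightarrow> P 0 \<and> P (1::nat) \<and> P 2"
  "(\<forall>j<4. P j) \<longleftrightarrow> P 0 \<and> P (1::nat) \<and> P 2 \<and> P 3"
  by (auto simp: eval_nat_numeral less_Suc_eq)

lemma prob_close_pair:
  "K \<ge> 5 \<Longrightarrow> order_prob K (\<lambda>l. close_pair K l k) = 2 / 15"
  "K = 4 \<Longrightarrow> order_prob K (\<lambda>l. close_pair K l k) = 1 / 6"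
  using prob_alternating_roots[of 2 K k, unfolded all_less_numeral_simps]
    prob_alternating_roots_cyclic[of K 1 k, unfolded one_add_one all_less_numeral_simps]
  by (simp_all add: close_pair_def zigzag_prob_values)

definition pair_prob :: "nat \<Rightarrow> nat \<Rightarrow> nat \<Rightarrow> real" where
  "pair_prob K d k = order_prob K (\<lambda>l. close_pair K l k \<and> close_pair K l (k + d))"

text \<open>The pair \<open>(k, k + K - d)\<close> is, modulo \<open>K\<close>, the pair \<open>(k', k' + d)\<close> with \<open>k' = k + K - d\<close>, in
  the other order.\<close>
lemma pair_prob_reflect:
  assumes "\<And>k. pair_prob K d k = c" "d \<le> K"
  shows "pair_prob K (K - d) k = c"
proof -
  have e: "k + (K - d) + d = k + K" using assms(2) by simp
  have "pair_prob K (K - d) k = pair_prob K d (k + (K - d))"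
    unfolding pair_prob_def e close_pair_add_period by (simp only: conj_commute)
  thus ?thesis using assms(1) by simp
qed

lemma pair_prob_0: "pair_prob K 0 k = order_prob K (\<lambda>l. close_pair K l k)"
  by (simp add: pair_prob_def)

text \<open>For \<open>d\<close> equal to 1 or 3 adjacent sites would both be roots.\<close>
lemma pair_prob_1: "pair_prob K 1 k = 0"
proof -
  have "\<not> (close_pair K l k \<and> close_pair K l (k + 1))" for l
    using not_root_after_Suc[of K l k] by (auto simp: close_pair_def)
  thus ?thesis unfolding pair_prob_def by (simp del: de_Morgan_conj)
qed

lemma pair_prob_3: "pair_prob K 3 k = 0"
proof -
  have "\<not> (close_pair K l k \<and> close_pair K l (k + 3))" for l
    using not_root_after_Suc[of K l "k + 2"] by (auto simp: close_pair_def numeral_3_eq_3)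
  thus ?thesis unfolding pair_prob_def by (simp del: de_Morgan_conj)
qed

text \<open>For \<open>d\<close> equal to 2 the events share a root, for \<open>d\<close> equal to 4 only the high point between the
  second and the third root. In both cases the two zigzags overlap to form a single longer one.\<close>
lemma pair_prob_2:
  "pair_prob K 2 k = order_prob K (\<lambda>l. \<forall>j<3. root_after K l (k + 2 * j))"
proof -
  have "(close_pair K l k \<and> close_pair K l (k + 2)) = (\<forall>j<3. root_after K l (k + 2 * j))" for l
    unfolding all_less_numeral_simps by (auto simp: close_pair_def eval_nat_numeral)
  thus ?thesis unfolding pair_prob_def by simp
qed

lemma pair_prob_4:
  "pair_prob K 4 k = order_prob K (\<lambda>l. \<forall>j<4. root_after K l (k + 2 * j))"
proof -
  have "(close_pair K l k \<and> close_pair K l (k + 4)) = (\<forall>j<4. root_after K l (k + 2 * j))" for l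
    unfolding all_less_numeral_simps by (auto simp: close_pair_def eval_nat_numeral)
  thus ?thesis unfolding pair_prob_def by simp
qed

text \<open>The zigzag with three roots involves the sites with indices \<open>k, \<dots>, k + 6\<close>. For \<open>K \<ge> 7\<close> these are
  distinct; for \<open>K = 6\<close> they close up to a cycle; for \<open>K = 5\<close> the roots \<open>k + 5\<close> and \<open>k + 1\<close> would
  be adjacent; and for \<open>K = 4\<close> the root \<open>k + 5\<close> coincides with \<open>k + 1\<close>.\<close>
lemma pair_prob_2_values:
  "K = 4 \<Longrightarrow> pair_prob K 2 k = 1 / 6"
  "K = 5 \<Longrightarrow> pair_prob K 2 k = 0"
  "K = 6 \<Longrightarrow> pair_prob K 2 k = 1 / 15"
  "K \<ge> 7 \<Longrightarrow> pair_prob K 2 k = 17 / 315"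
proof -
  show "pair_prob K 2 k = 1 / 6" if K: "K = 4"
  proof -
    have "close_pair K l k \<and> close_pair K l (k + 2) \<longleftrightarrow> close_pair K l k" for l
      using root_after_add_period[of K l k] by (auto simp: close_pair_def K eval_nat_numeral)
    thus ?thesis using prob_close_pair(2)[OF K] by (simp add: pair_prob_def)
  qed
  show "pair_prob K 2 k = 0" if K: "K = 5"
  proof -
    have "\<not> (close_pair K l k \<and> close_pair K l (k + 2))" for l
      using root_after_add_period[of K l k] not_root_after_Suc[of K l "k + 4"]
      by (auto simp: close_pair_def K eval_nat_numeral)
    thus ?thesis unfolding pair_prob_def by (simp del: de_Morgan_conj)
  qed
  show "pair_prob K 2 k = 1 / 15" if "K = 6"
    using prob_alternating_roots_cyclic[of K 2 k] that by (simp add: pair_prob_2 zigzag_prob_values)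
  show "pair_prob K 2 k = 17 / 315" if "K \<ge> 7"
    using prob_alternating_roots[of 3 K k] that by (simp add: pair_prob_2 zigzag_prob_values)
qed

text \<open>The zigzag with four roots involves the sites with indices \<open>k, \<dots>, k + 8\<close>.\<close>
lemma pair_prob_4_values:
  "K = 8 \<Longrightarrow> pair_prob K 4 k = 17 / 630"
  "K \<ge> 9 \<Longrightarrow> pair_prob K 4 k = 62 / 2835"
  using prob_alternating_roots_cyclic[of K 3 k] prob_alternating_roots[of 4 K k]
  by (simp_all add: pair_prob_4 zigzag_prob_values)

text \<open>The two windows of five sites are disjoint, so the two zigzags are independent.\<close>
lemma pair_prob_far:
  assumes "5 \<le> d" "d + 5 \<le> K"
  shows "pair_prob K d k = 4 / 225"
proof -
  have cp: "close_pair K l k \<longleftrightarrow> zigzag l (window K 5 k)" for l k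
    using zigzag_window[of l K 2 k] by (simp add: close_pair_def all_less_numeral_simps)
  have "set (window K 5 k) \<inter> set (window K 5 (k + d)) = {}"
  proof -
    have "site K (k + i) \<noteq> site K (k + d + j)" if "i < 5" "j < 5" for i j
      using inj_onD[OF inj_site[of K k], of i "d + j"] that assms by (auto simp: add.assoc)
    thus ?thesis unfolding set_window by blast
  qed
  hence "pair_prob K d k =
    measure_pmf.prob (perm_pmf (set (window K 5 k))) {l. zigzag l (window K 5 k)} *
    measure_pmf.prob (perm_pmf (set (window K 5 (k + d)))) {l. zigzag l (window K 5 (k + d))}"
    unfolding pair_prob_def cp using assms
    by (intro prob_zigzag_indep set_window_subset) simp_all
  moreover have "measure_pmf.prob (perm_pmf (set (window K 5 k))) {l. zigzag l (window K 5 k)} = 2 / 15" for k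
    using prob_zigzag[of "set (window K 5 k)" "window K 5 k" 2] assms
    by (simp add: distinct_window length_window zigzag_prob_values)
  ultimately show ?thesis by simp
qed

lemma sum_periodic_shift:
  fixes F :: "nat \<Rightarrow> 'b::cancel_comm_monoid_add"
  assumes "\<And>i. F (i + K) = F i"
  shows "(\<Sum>i<K. F (i + d)) = (\<Sum>i<K. F i)"
proof (induction d)
  case (Suc d)
  have "F (0 + d) + (\<Sum>i<K. F (Suc i + d)) = (\<Sum>i<K. F (i + d)) + F (K + d)"
    using sum.lessThan_Suc_shift[of "\<lambda>i. F (i + d)" K] sum.lessThan_Suc[of "\<lambda>i. F (i + d)" K] by simp
  moreover have "F (K + d) = F (0 + d)" using assms[of d] by (simp add: add.commute)
  ultimately have "(\<Sum>i<K. F (Suc i + d)) = (\<Sum>i<K. F (i + d))"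
    by (simp add: add.commute)
  thus ?case using Suc by simp
qed simp

lemma expectation_of_bool:
  "measure_pmf.expectation p (\<lambda>l. of_bool (P l)) = measure_pmf.prob p {l. P l}"
proof -
  have "(\<lambda>l. of_bool (P l) :: real) = indicator {l. P l}" by (auto simp: indicator_def)
  thus ?thesis by simp
qed

lemma first_moment:
  "measure_pmf.expectation (perm_pmf {1..K}) (\<lambda>l. \<Sum>k<K. of_bool (close_pair K l k)) =
    (\<Sum>k<K. order_prob K (\<lambda>l. close_pair K l k))"
  by (simp add: Bochner_Integration.integral_sum integrable_measure_pmf_finite
      expectation_of_bool)

text \<open>In the expansion of the square the second index is written as \<open>k + d\<close>, which runs through all
  residues together with \<open>d\<close>.\<close>
lemma second_moment:
  "measure_pmf.expectation (perm_pmf {1..K}) (\<lambda>l. (\<Sum>k<K. of_bool (close_pair K l k))\<^sup>2) =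
    (\<Sum>k<K. \<Sum>d<K. pair_prob K d k)"
proof -
  have "(\<Sum>k<K. of_bool (close_pair K l k))\<^sup>2 =
    (\<Sum>k<K. \<Sum>d<K. of_bool (close_pair K l k \<and> close_pair K l (k + d)) :: real)" for l
  proof -
    have "(\<Sum>k<K. of_bool (close_pair K l k))\<^sup>2 =
      (\<Sum>k<K. \<Sum>j<K. of_bool (close_pair K l k) * of_bool (close_pair K l j) :: real)"
      by (simp add: power2_eq_square sum_product)
    also have "\<dots> = (\<Sum>k<K. \<Sum>d<K. of_bool (close_pair K l k) * of_bool (close_pair K l (d + k)))"
      by (intro sum.cong refl sum_periodic_shift[symmetric]) (simp add: close_pair_add_period)
    finally show ?thesis by (simp add: of_bool_conj add.commute)
  qed
  thus ?thesis
    by (simp add: pair_prob_def Bochner_Integration.integral_sum integrable_measure_pmf_finite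
        expectation_of_bool)
qed

lemma sum_pair_prob_large:
  assumes "K \<ge> 9"
  shows "(\<Sum>d<K. pair_prob K d k) = 2 / 15 + 2 * (17 / 315) + 2 * (62 / 2835) + (K - 9) * (4 / 225)"
proof -
  define m where "m = K - 9"
  have K: "K = m + 9" using assms by (simp add: m_def)
  have s: "{..<K} = {0, 1, 2, 3, 4} \<union> {5..<m + 5} \<union> {K - 4, K - 3, K - 2, K - 1}"
    unfolding K by auto
  have "(\<Sum>d<K. pair_prob K d k) = (\<Sum>d\<in>{0, 1, 2, 3, 4}. pair_prob K d k) +
      (\<Sum>d\<in>{5..<m + 5}. pair_prob K d k) + (\<Sum>d\<in>{K - 4, K - 3, K - 2, K - 1}. pair_prob K d k)"
    unfolding s by (subst sum.union_disjoint; (subst sum.union_disjoint)?) (auto simp: K)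
  also have "(\<Sum>d\<in>{5..<m + 5}. pair_prob K d k) = (\<Sum>d\<in>{5..<m + 5}. 4 / 225)"
    by (intro sum.cong refl pair_prob_far) (auto simp: K)
  also have "\<dots> = (K - 9) * (4 / 225)" by (simp add: K)
  also have "(\<Sum>d\<in>{0, 1, 2, 3, 4}. pair_prob K d k) = 2 / 15 + 17 / 315 + 62 / 2835"
    using assms by (simp add: pair_prob_0 prob_close_pair[unfolded One_nat_def]
        pair_prob_1[unfolded One_nat_def] pair_prob_3
        pair_prob_2_values pair_prob_4_values)
  also have "(\<Sum>d\<in>{K - 4, K - 3, K - 2, K - 1}. pair_prob K d k) =
      pair_prob K (K - 4) k + pair_prob K (K - 3) k + pair_prob K (K - 2) k + pair_prob K (K - 1) k"
  proof -
    have "K - 4 \<noteq> K - 3" "K - 4 \<noteq> K - 2" "K - 4 \<noteq> K - 1"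
      "K - 3 \<noteq> K - 2" "K - 3 \<noteq> K - 1" "K - 2 \<noteq> K - 1"
      using assms by auto
    thus ?thesis by simp
  qed
  also have "\<dots> = 62 / 2835 + 0 + 17 / 315 + 0"
    using assms pair_prob_reflect[of K 4 "62 / 2835" k] pair_prob_reflect[of K 3 0 k]
      pair_prob_reflect[of K 1 0 k] pair_prob_reflect[of K 2 "17 / 315" k]
    by (simp only: pair_prob_4_values pair_prob_3 pair_prob_1 pair_prob_2_values)
  finally show ?thesis using assms by (simp add: of_nat_diff)
qed

lemma sum_pair_prob_small:
  "K = 4 \<Longrightarrow> (\<Sum>d<K. pair_prob K d k) = 1 / 3"
  "K = 5 \<Longrightarrow> (\<Sum>d<K. pair_prob K d k) = 2 / 15"
  "K = 6 \<Longrightarrow> (\<Sum>d<K. pair_prob K d k) = 2 / 15 + 2 / 15"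
  "K = 7 \<Longrightarrow> (\<Sum>d<K. pair_prob K d k) = 2 / 15 + 34 / 315"
  "K = 8 \<Longrightarrow> (\<Sum>d<K. pair_prob K d k) = 2 / 15 + 34 / 315 + 17 / 630"
proof -
  have sums: "(\<Sum>d<4. f d) = f 0 + f 1 + f 2 + f 3"
    "(\<Sum>d<5. f d) = f 0 + f 1 + f 2 + f 3 + f 4"
    "(\<Sum>d<6. f d) = f 0 + f 1 + f 2 + f 3 + f 4 + f 5"
    "(\<Sum>d<7. f d) = f 0 + f 1 + f 2 + f 3 + f 4 + f 5 + f 6"
    "(\<Sum>d<8. f d) = f 0 + f 1 + f 2 + f 3 + f 4 + f 5 + f 6 + f 7" for f :: "nat \<Rightarrow> real"
    by (simp_all add: eval_nat_numeral)
  have r1: "pair_prob K (K - 1) k = 0" if "K \<ge> 1"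
    using pair_prob_reflect[of K 1, OF pair_prob_1] that by simp
  have r3: "pair_prob K (K - 3) k = 0" if "K \<ge> 3"
    using pair_prob_reflect[of K 3, OF pair_prob_3] that by simp
  have r2: "K = 6 \<Longrightarrow> pair_prob K (K - 2) k = 1 / 15" "K \<ge> 7 \<Longrightarrow> pair_prob K (K - 2) k = 17 / 315"
    by (rule pair_prob_reflect; simp add: pair_prob_2_values)+
  note v = pair_prob_0 prob_close_pair[unfolded One_nat_def] pair_prob_1[unfolded One_nat_def] pair_prob_3 pair_prob_2_values pair_prob_4_values
  show "(\<Sum>d<K. pair_prob K d k) = 1 / 3" if K: "K = 4"
    by (simp add: K sums v)
  show "(\<Sum>d<K. pair_prob K d k) = 2 / 15" if K: "K = 5"
    using r1 by (simp add: K sums v)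
  show "(\<Sum>d<K. pair_prob K d k) = 2 / 15 + 2 / 15" if K: "K = 6"
    using r1 r2 by (simp add: K sums v)
  show "(\<Sum>d<K. pair_prob K d k) = 2 / 15 + 34 / 315" if K: "K = 7"
    using r1 r2 r3 by (simp add: K sums v)
  show "(\<Sum>d<K. pair_prob K d k) = 2 / 15 + 34 / 315 + 17 / 630" if K: "K = 8"
    using r1 r2 r3 by (simp add: K sums v)
qed

section \<open>From permutations to the deposition process\<close>

context uniform_site_sequence
begin

text \<open>This holds on the whole sample space, also where some site is never hit: the first particle
  always creates a root, and two adjacent sites cannot each be hit before the other. It therefore
  also yields the measurability of the number of gaps.\<close>
lemma num_gaps_1_sum:
  assumes "K \<ge> 4" "\<omega> \<in> space M"
  shows "num_gaps 1 K (\<lambda>n. X n \<omega>) =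
    (\<Sum>k<K. of_bool (site K (k + 1) \<in> roots K (\<lambda>n. X n \<omega>) \<and> site K (k + 3) \<in> roots K (\<lambda>n. X n \<omega>)))"
proof -
  define x where "x = (\<lambda>n. X n \<omega>)"
  define F where "F i = (of_bool (site K i \<in> roots K x \<and> site K (i + 2) \<in> roots K x) :: nat)" for i
  have "x 1 \<in> {1..K}" unfolding x_def by (rule X_in_sites[OF assms(2)])
  moreover have "\<exists>i\<ge>1. Defs.height K x i (x 1) = 1"
    unfolding height_eq_1_iff by (intro exI[of _ 1]) simp
  ultimately have ne: "roots K x \<noteq> {}" unfolding roots_def by blast
  have adj: "site K (i + 1) \<notin> roots K x" if "site K i \<in> roots K x" for i
  proof
    define i' where "i' = i + K - 1"
    have i': "i' + 1 = i + K" "i' + 2 = i + 1 + K" using assms(1) by (auto simp: i'_def)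
    have "site K (i' + 1) \<in> roots K x" using that unfolding i' site_add_period .
    hence "hits_before x (site K i) (site K (i + 1))"
      using site_in_roots_iff[of K i' x] assms(1) unfolding i' site_add_period by simp
    moreover assume "site K (i + 1) \<in> roots K x"
    hence "hits_before x (site K (i + 1)) (site K i)"
      using site_in_roots_iff[of K i x] assms(1) by simp
    ultimately show False using hits_before_asym by blast
  qed
  have "num_gaps 1 K x = (\<Sum>i<K. F i)"
    unfolding F_def by (rule num_gaps_1_eq[OF assms(1) ne adj])
  also have "\<dots> = (\<Sum>i<K. F (i + 1))"
  proof (rule sum_periodic_shift[symmetric])
    fix i
    have "i + K + 2 = i + 2 + K" by simp
    thus "F (i + K) = F i" unfolding F_def by (simp only: site_add_period)
  qed
  also have "\<dots> = (\<Sum>k<K. of_bool (site K (k + 1) \<in> roots K x \<and> site K (k + 3) \<in> roots K x))"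
    by (simp add: F_def numeral_3_eq_3)
  finally show ?thesis by (simp add: x_def)
qed

lemma num_gaps_1_measurable:
  assumes "K \<ge> 4"
  shows "(\<lambda>\<omega>. real (num_gaps 1 K (\<lambda>n. X n \<omega>))) \<in> borel_measurable M"
proof -
  note pred_hits_before[OF X_measurable, measurable]
  have "K \<ge> 3" using assms by simp
  have root [measurable]: "Measurable.pred M (\<lambda>\<omega>. site K (i + 1) \<in> roots K (\<lambda>n. X n \<omega>))" for i
    unfolding site_in_roots_iff[OF \<open>K \<ge> 3\<close>] by measurable
  have [measurable]: "Measurable.pred M (\<lambda>\<omega>. site K (i + 3) \<in> roots K (\<lambda>n. X n \<omega>))" for i
    using root[of "i + 2"] by (simp add: numeral_3_eq_3)
  have "(\<lambda>\<omega>. \<Sum>k<K. of_bool (site K (k + 1) \<in> roots K (\<lambda>n. X n \<omega>) \<and>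
      site K (k + 3) \<in> roots K (\<lambda>n. X n \<omega>)) :: real) \<in> borel_measurable M"
    unfolding of_bool_def by measurable
  thus ?thesis
    by (rule measurable_cong[THEN iffD1, rotated]) (simp add: num_gaps_1_sum[OF assms, unfolded One_nat_def])
qed

lemma num_gaps_1_order:
  assumes "K \<ge> 4" "l \<in> permutations_of_set {1..K}" "\<omega> \<in> order_event l"
  shows "real (num_gaps 1 K (\<lambda>n. X n \<omega>)) = (\<Sum>k<K. of_bool (close_pair K l k))"
proof -
  have "site K i \<in> set l" for i
    using site_range[OF K_pos] assms(2) by (simp add: permutations_of_set_def del: atLeastAtMost_iff)
  hence "precedes l (site K i) (site K j) \<longleftrightarrow> hits_before (\<lambda>n. X n \<omega>) (site K i) (site K j)" for i j
    using assms(3) by (intro precedes_iff_hits_before) (auto simp: order_event_def)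
  hence root: "site K (k + 1) \<in> roots K (\<lambda>n. X n \<omega>) \<longleftrightarrow> root_after K l k" for k
    using assms(1) by (subst site_in_roots_iff) (auto simp: root_after_def)
  have "site K (k + 3) \<in> roots K (\<lambda>n. X n \<omega>) \<longleftrightarrow> root_after K l (k + 2)" for k
    using root[of "k + 2"] by (simp add: numeral_3_eq_3)
  moreover have "\<omega> \<in> space M" using assms(3) by (simp add: order_event_def)
  ultimately show ?thesis
    using root by (simp add: num_gaps_1_sum[OF assms(1), unfolded One_nat_def] close_pair_def)
qed

theorem expectation_num_gaps_1:
  assumes "K \<ge> 4"
  shows "expectation (\<lambda>\<omega>. real (num_gaps 1 K (\<lambda>n. X n \<omega>))) =
    (\<Sum>k<K. order_prob K (\<lambda>l. close_pair K l k))"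
  unfolding first_moment[symmetric]
  by (rule expectation_first_hit_order) (use num_gaps_1_measurable num_gaps_1_order assms in auto)

text \<open>The squared deviation from the mean is itself a function of the order of first hits, so that
  the variance can be computed for the uniform permutation.\<close>
theorem variance_num_gaps_1:
  assumes "K \<ge> 4"
  shows "variance (\<lambda>\<omega>. real (num_gaps 1 K (\<lambda>n. X n \<omega>))) =
    (\<Sum>k<K. \<Sum>d<K. pair_prob K d k) - (\<Sum>k<K. order_prob K (\<lambda>l. close_pair K l k))\<^sup>2"
proof -
  let ?p = "measure_pmf (perm_pmf {1..K})"
  define S where "S l = (\<Sum>k<K. of_bool (close_pair K l k) :: real)" for l
  define c where "c = expectation (\<lambda>\<omega>. real (num_gaps 1 K (\<lambda>n. X n \<omega>)))"
  have c: "c = integral\<^sup>L ?p S" "c = (\<Sum>k<K. order_prob K (\<lambda>l. close_pair K l k))"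
    unfolding c_def S_def first_moment by (rule expectation_num_gaps_1[OF assms])+
  have "variance (\<lambda>\<omega>. real (num_gaps 1 K (\<lambda>n. X n \<omega>))) = integral\<^sup>L ?p (\<lambda>l. (S l - c)\<^sup>2)"
    unfolding c_def[symmetric]
  proof (rule expectation_first_hit_order)
    note num_gaps_1_measurable[OF assms, measurable]
    show "(\<lambda>\<omega>. (real (num_gaps 1 K (\<lambda>n. X n \<omega>)) - c)\<^sup>2) \<in> borel_measurable M" by measurable
  qed (simp add: num_gaps_1_order[OF assms, unfolded One_nat_def] S_def)
  also have "\<dots> = integral\<^sup>L ?p (\<lambda>l. (S l)\<^sup>2) - c\<^sup>2"
    unfolding c(1) by (rule measure_pmf.variance_eq) (auto intro!: integrable_measure_pmf_finite)
  also have "integral\<^sup>L ?p (\<lambda>l. (S l)\<^sup>2) = (\<Sum>k<K. \<Sum>d<K. pair_prob K d k)"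
    unfolding S_def by (rule second_moment)
  finally show ?thesis by (simp add: c(2))
qed

end

theorem theorem3:
  fixes M :: "'a measure" and K :: nat and X :: "nat \<Rightarrow> 'a \<Rightarrow> nat" and D :: "'a \<Rightarrow> real"
  assumes "K \<ge> 3"
    and "prob_space M"
    and "prob_space.indep_vars M (\<lambda>_. count_space {1..K}) X UNIV"
    and "\<And>n. distr M (count_space {1..K}) (X n) = uniform_count_measure {1..K}"
  defines "D \<equiv> \<lambda>\<omega>. real (num_gaps 1 K (\<lambda>n. X n \<omega>))"
  shows "(K = 4 \<longrightarrow> prob_space.expectation M D = 2 / 3) \<and>
    (K \<ge> 5 \<longrightarrow> prob_space.expectation M D = 2 * real K / 15) \<and>
    (K = 4 \<longrightarrow> prob_space.variance M D = 8 / 9) \<and>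
    (K = 5 \<longrightarrow> prob_space.variance M D = 2 / 9) \<and>
    (K = 6 \<longrightarrow> prob_space.variance M D = 24 / 25) \<and>
    (K = 7 \<longrightarrow> prob_space.variance M D = 184 / 225) \<and>
    (K = 8 \<longrightarrow> prob_space.variance M D = 1588 / 1575) \<and>
    (K \<ge> 9 \<longrightarrow> prob_space.variance M D = 1772 * real K / 14175)"
proof -
  interpret prob_space M by fact
  interpret uniform_site_sequence M K X
    by unfold_locales (use assms in auto)
  have E: "expectation D = K * p"
    if "K \<ge> 4" "\<And>k. order_prob K (\<lambda>l. close_pair K l k) = p" for p :: real
    unfolding D_def expectation_num_gaps_1[OF that(1)] that(2) by simp
  have V: "variance D = K * s - (K * p)\<^sup>2"
    if "K \<ge> 4" "\<And>k. (\<Sum>d<K. pair_prob K d k) = s" "\<And>k. order_prob K (\<lambda>l. close_pair K l k) = p"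
    for s p :: real
    unfolding D_def variance_num_gaps_1[OF that(1)] that(2,3) by simp
  have E4: "expectation D = 2 / 3" if "K = 4"
    using E[OF _ prob_close_pair(2)[OF that]] that by simp
  have E5: "expectation D = 2 * real K / 15" if "K \<ge> 5"
    using E[OF _ prob_close_pair(1)[OF that]] that by simp
  have "variance D = 8 / 9" if "K = 4"
    using V[OF _ sum_pair_prob_small(1)[OF that] prob_close_pair(2)[OF that]] that
    by (simp add: power2_eq_square)
  moreover have "variance D = 2 / 9" if "K = 5"
    using V[OF _ sum_pair_prob_small(2)[OF that] prob_close_pair(1)] that
    by (simp add: power2_eq_square)
  moreover have "variance D = 24 / 25" if "K = 6"
    using V[OF _ sum_pair_prob_small(3)[OF that] prob_close_pair(1)] that
    by (simp add: power2_eq_square)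
  moreover have "variance D = 184 / 225" if "K = 7"
    using V[OF _ sum_pair_prob_small(4)[OF that] prob_close_pair(1)] that
    by (simp add: power2_eq_square)
  moreover have "variance D = 1588 / 1575" if "K = 8"
    using V[OF _ sum_pair_prob_small(5)[OF that] prob_close_pair(1)] that
    by (simp add: power2_eq_square)
  moreover have "variance D = 1772 * real K / 14175" if "K \<ge> 9"
    using V[OF _ sum_pair_prob_large[OF that] prob_close_pair(1)] that
    by (simp add: power2_eq_square of_nat_diff field_simps)
  ultimately show ?thesis using E4 E5 by blast
qed

end
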